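(* Let $L\ge2$, $D\ge1$, and consider depth-$L$ linear convolutional networks with parameters $\mathbf{u}=[\mathbf{u}_l]_{l=1}^L$, $\mathbf{u}_l\in\mathbb{R}^D$, computing $f_{\mathbf{u}}(\mathbf{x})=\big((((\mathbf{x}\star\mathbf{u}_1)\star\mathbf{u}_2)\cdots)\star\mathbf{u}_{L-1}\big)^\top\mathbf{u}_L=\langle\mathbf{x},\mathcal{P}_{conv}(\mathbf{u})\rangle$. For almost all linearly separable datasets $\{(\mathbf{x}_n,y_n)\}_{n=1}^N\subset\mathbb{R}^D\times\{-1,1\}$, almost all initializations $\mathbf{u}^{(0)}$, and any step sizes $\{\eta_t\}$ with $\eta_t$ smaller than the local Lipschitz constant at $\mathbf{u}^{(t)}$, consider gradient descent $\mathbf{u}^{(t+1)}=\mathbf{u}^{(t)}-\eta_t\nabla_{\mathbf{u}}\mathcal{L}_{\mathcal{P}_{conv}}(\mathbf{u}^{(t)})$ with $\mathcal{L}_{\mathcal{P}_{conv}}(\mathbf{u})=\sum_n\exp(-y_n\langle\mathbf{x}_n,\mathcal{P}_{conv}(\mathbf{u})\rangle)$; let $\mathbf{w}^{(t)}=\mathcal{P}_{conv}(\mathbf{u}^{(t)})$ and $\mathcal{L}(\mathbf{w})=\sum_n\exp(-y_n\langle\mathbf{x}_n,\mathbf{w}\rangle)$. Suppose (a) $\mathcal{L}_{\mathcal{P}_{conv}}(\mathbf{u}^{(t)})\to0$; (b) $\mathbf{u}^{(t)}$ converges in direction, yielding $\bar{\mathbf{w}}^\infty=\lim_t\mathbf{w}^{(t)}/\|\mathbf{w}^{(t)}\|$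 with $\min_ny_n\langle\mathbf{x}_n,\bar{\mathbf{w}}^\infty\rangle>0$; (c) for every $d$, $e^{\mathrm{i}\phi_{\hat{\mathbf{w}}^{(t)}[d]}}$ converges; (d) $\nabla_{\mathbf{w}}\mathcal{L}(\mathbf{w}^{(t)})$ converges in direction. Then $\bar{\mathbf{w}}^\infty$ is a positive scaling of a first order stationary point of $$\min_{\mathbf{w}}\|\hat{\mathbf{w}}\|_{2/L}\ \text{ s.t. }\ \forall n,\ y_n\langle\mathbf{w},\mathbf{x}_n\rangle\ge1.$$
   Context: Circular convolution: $(\mathbf{h}\star\mathbf{u})[d]=\frac{1}{\sqrt D}\sum_{k=0}^{D-1}\mathbf{u}[k]\mathbf{h}[(d+k)\bmod D]$ (indices $0,\dots,D-1$). DFT: $\hat{\mathbf{w}}[d]=\frac{1}{\sqrt D}\sum_{p}\mathbf{w}[p]e^{-2\pi\mathrm{i}pd/D}$; complex numbers are written $z=|z|e^{\mathrm{i}\phi_z}$, $\phi_z\in[0,2\pi)$. For $p>0$, $\|\mathbf{z}\|_p=(\sum_i|\mathbf{z}[i]|^p)^{1/p}$. With $p=2/L$, a first order stationary point of the problem is a feasible $\mathbf{w}$ for which there exist $\alpha_n\ge0$ with $\alpha_n=0$ whenever $y_n\langle\mathbf{x}_n,\mathbf{w}\rangle>1$, and $\sum_n\alpha_ny_n\hat{\mathbf{x}}_n\in\partial^\circ\|\hat{\mathbf{w}}\|_p$, where $\partial^\circ$ is the Clarke (local) subdifferential; concretely, for $p=1$, $\partial^\circ\|\hat{\mathbf{w}}\|_1=\{\hat{\mathbf{z}}:\forall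 d,\ |\hat{\mathbf{z}}[d]|\le1,\ \hat{\mathbf{w}}[d]\neq0\Rightarrow\hat{\mathbf{z}}[d]=e^{\mathrm{i}\phi_{\hat{\mathbf{w}}[d]}}\}$, and for $p<1$, $\partial^\circ\|\hat{\mathbf{w}}\|_p=\{\hat{\mathbf{z}}:\hat{\mathbf{w}}[d]\neq0\Rightarrow\hat{\mathbf{z}}[d]=p\,e^{\mathrm{i}\phi_{\hat{\mathbf{w}}[d]}}|\hat{\mathbf{w}}[d]|^{p-1}\}$. "Converges in direction" means the normalized sequence has a limit; "almost all" means outside a Lebesgue-null set. *)

theory Defs
  imports "HOL-Analysis.Analysis"
begin

text \<open>Vectors in R^D are functions nat => real, only indices 0..D-1 matter.
 Network parameters u = [u_l]_{l=1..L} are functions nat => nat => real (u l k = u_l[k]).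
 Datasets: x n = x_n (n < N), labels y n.\<close>

definition inner_D :: "nat \<Rightarrow> (nat \<Rightarrow> real) \<Rightarrow> (nat \<Rightarrow> real) \<Rightarrow> real" where
  "inner_D D a b = (\<Sum>k<D. a k * b k)"

definition vnorm :: "nat \<Rightarrow> (nat \<Rightarrow> real) \<Rightarrow> real" where
  "vnorm D w = sqrt (\<Sum>k<D. (w k)^2)"

definition circ_conv :: "nat \<Rightarrow> (nat \<Rightarrow> real) \<Rightarrow> (nat \<Rightarrow> real) \<Rightarrow> (nat \<Rightarrow> real)" where
  "circ_conv D h u = (\<lambda>d. (1 / sqrt (real D)) * (\<Sum>k<D. u k * h ((d + k) mod D)))"

fun conv_chain :: "nat \<Rightarrow> (nat \<Rightarrow> nat \<Rightarrow> real) \<Rightarrow> (nat \<Rightarrow> real) \<Rightarrow> nat \<Rightarrow> (nat \<Rightarrow> real)" where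
  "conv_chain D u x 0 = x"
| "conv_chain D u x (Suc l) = circ_conv D (conv_chain D u x l) (u (Suc l))"

definition lin_conv_net :: "nat \<Rightarrow> nat \<Rightarrow> (nat \<Rightarrow> nat \<Rightarrow> real) \<Rightarrow> (nat \<Rightarrow> real) \<Rightarrow> real" where
  "lin_conv_net D L u x = inner_D D (conv_chain D u x (L - 1)) (u L)"

text \<open>P_conv(u): the linear predictor with <x, P_conv(u)> = f_u(x)\<close>
definition P_conv :: "nat \<Rightarrow> nat \<Rightarrow> (nat \<Rightarrow> nat \<Rightarrow> real) \<Rightarrow> (nat \<Rightarrow> real)" where
  "P_conv D L u = (\<lambda>k. if k < D then lin_conv_net D L u (\<lambda>j. if j = k then 1 else 0) else 0)"

definition dft :: "nat \<Rightarrow> (nat \<Rightarrow> real) \<Rightarrow> (nat \<Rightarrow> complex)" where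
  "dft D w = (\<lambda>d. complex_of_real (1 / sqrt (real D)) *
      (\<Sum>p<D. complex_of_real (w p) * cis (- 2 * pi * real p * real d / real D)))"

definition phase :: "complex \<Rightarrow> complex" where
  "phase z = cis (Arg z)"

definition exp_loss :: "nat \<Rightarrow> nat \<Rightarrow> (nat \<Rightarrow> nat \<Rightarrow> real) \<Rightarrow> (nat \<Rightarrow> real) \<Rightarrow> (nat \<Rightarrow> real) \<Rightarrow> real" where
  "exp_loss D N x y w = (\<Sum>n<N. exp (- y n * inner_D D (x n) w))"

definition conv_loss :: "nat \<Rightarrow> nat \<Rightarrow> nat \<Rightarrow> (nat \<Rightarrow> nat \<Rightarrow> real) \<Rightarrow> (nat \<Rightarrow> real)
    \<Rightarrow> (nat \<Rightarrow> nat \<Rightarrow> real) \<Rightarrow> real" where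
  "conv_loss D L N x y u = exp_loss D N x y (P_conv D L u)"

definition grad_params :: "nat \<Rightarrow> nat \<Rightarrow> nat \<Rightarrow> (nat \<Rightarrow> nat \<Rightarrow> real) \<Rightarrow> (nat \<Rightarrow> real)
    \<Rightarrow> (nat \<Rightarrow> nat \<Rightarrow> real) \<Rightarrow> (nat \<Rightarrow> nat \<Rightarrow> real)" where
  "grad_params D L N x y u =
     (\<lambda>l k. deriv (\<lambda>s. conv_loss D L N x y (u(l := (u l)(k := s)))) (u l k))"

definition grad_w :: "nat \<Rightarrow> nat \<Rightarrow> (nat \<Rightarrow> nat \<Rightarrow> real) \<Rightarrow> (nat \<Rightarrow> real)
    \<Rightarrow> (nat \<Rightarrow> real) \<Rightarrow> (nat \<Rightarrow> real)" where
  "grad_w D N x y w = (\<lambda>k. deriv (\<lambda>s. exp_loss D N x y (w(k := s))) (w k))"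

definition pnorm :: "nat \<Rightarrow> nat \<Rightarrow> (nat \<Rightarrow> nat \<Rightarrow> real) \<Rightarrow> real" where
  "pnorm D L u = sqrt (\<Sum>l\<in>{1..L}. \<Sum>k<D. (u l k)^2)"

definition pdist :: "nat \<Rightarrow> nat \<Rightarrow> (nat \<Rightarrow> nat \<Rightarrow> real) \<Rightarrow> (nat \<Rightarrow> nat \<Rightarrow> real) \<Rightarrow> real" where
  "pdist D L u v = pnorm D L (\<lambda>l k. u l k - v l k)"

text \<open>Step size eta is below the inverse of the local Lipschitz constant of the gradient
  at u (Lipschitz on the ball around u that contains the gradient step).\<close>
definition step_size_ok :: "nat \<Rightarrow> nat \<Rightarrow> nat \<Rightarrow> (nat \<Rightarrow> nat \<Rightarrow> real) \<Rightarrow> (nat \<Rightarrow> real)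
    \<Rightarrow> (nat \<Rightarrow> nat \<Rightarrow> real) \<Rightarrow> real \<Rightarrow> bool" where
  "step_size_ok D L N x y u \<eta> \<longleftrightarrow> 0 < \<eta> \<and>
     (\<exists>\<beta>\<ge>0. \<eta> * \<beta> < 1 \<and>
        (\<forall>v v'. pdist D L v u \<le> \<eta> * pnorm D L (grad_params D L N x y u) \<longrightarrow>
                pdist D L v' u \<le> \<eta> * pnorm D L (grad_params D L N x y u) \<longrightarrow>
                pdist D L (grad_params D L N x y v) (grad_params D L N x y v')
                  \<le> \<beta> * pdist D L v v'))"

definition clarke_subdiff_pnorm :: "nat \<Rightarrow> real \<Rightarrow> (nat \<Rightarrow> complex) \<Rightarrow> (nat \<Rightarrow> complex) \<Rightarrow> bool" where
  "clarke_subdiff_pnorm D p wh z \<longleftrightarrow>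
     (if p = 1 then (\<forall>d<D. cmod (z d) \<le> 1 \<and> (wh d \<noteq> 0 \<longrightarrow> z d = phase (wh d)))
      else (\<forall>d<D. wh d \<noteq> 0 \<longrightarrow>
              z d = complex_of_real (p * cmod (wh d) powr (p - 1)) * phase (wh d)))"

definition first_order_stationary :: "nat \<Rightarrow> nat \<Rightarrow> nat \<Rightarrow> (nat \<Rightarrow> nat \<Rightarrow> real)
    \<Rightarrow> (nat \<Rightarrow> real) \<Rightarrow> (nat \<Rightarrow> real) \<Rightarrow> bool" where
  "first_order_stationary D L N x y w \<longleftrightarrow>
     (\<forall>n<N. y n * inner_D D w (x n) \<ge> 1) \<and>
     (\<exists>\<alpha>::nat \<Rightarrow> real. (\<forall>n<N. \<alpha> n \<ge> 0 \<and> (y n * inner_D D (x n) w > 1 \<longrightarrow> \<alpha> n = 0)) \<and>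
        clarke_subdiff_pnorm D (2 / real L) (dft D w)
          (\<lambda>d. \<Sum>n<N. complex_of_real (\<alpha> n * y n) * dft D (x n) d))"

definition linearly_separable :: "nat \<Rightarrow> nat \<Rightarrow> (nat \<Rightarrow> nat \<Rightarrow> real) \<Rightarrow> (nat \<Rightarrow> real) \<Rightarrow> bool" where
  "linearly_separable D N x y \<longleftrightarrow> (\<exists>w. \<forall>n<N. y n * inner_D D (x n) w > 0)"

end

(* In the Fourier domain the predictor is the pointwise product of the layers, so gradient descent
   decouples over frequencies up to the common residual z_t = - grad L(w_t): with U_l the transform
   of layer l, U_l gains eta_t * Z_t * cnj (prod over j /= l of U_j).

   The step-size condition bounds the curvature in every direction. Tested on two layers at one
   frequency, it makes | |U_l|^2 - |U_k|^2 | nonincreasing, so in the limit direction all layers have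
   equal modulus at each frequency. A Stolz-Cesaro argument turns convergence of z_t / |z_t| into
   kappa * Ubar_l = Zbar * cnj (prod over j /= l of Ubar_j), which gives
   Zbar = kappa * |Omega|^(2/L - 1) * sgn Omega wherever Omega = prod_l Ubar_l is nonzero; the dual
   variables are limits of exp(- margin) / |z_t|, which vanish off the support vectors.

   For L = 2 the bound |Zbar| <= kappa is also needed where Omega = 0. If it failed, the expanding
   combination U_1 + xi * cnj U_2 (xi the limiting phase of Z) would outgrow all active frequencies.
   It can only fail to take over if |U_1|^2 - |U_2|^2, which shrinks by exactly 1 - |eta Z|^2 per
   step, is zero from the start; this is the null set of excluded initializations. *)
theory Submission
  imports Defs
begin

section \<open>The discrete Fourier transform\<close>

text \<open>The exponent 2/L equals 1 exactly for L = 2, and only then does the subdifferential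
  constrain frequencies where the limit vanishes. There the limit identity kappa * Ubar_1 = Zbar *
  cnj Ubar_2 reads 0 = 0, so passing to the limit cannot bound |Zbar|; the trajectory itself has to
  be compared with that of an active frequency. The danger is a trajectory hiding in the contracting
  combination U_1 - xi * cnj U_2. That combination shrinks to first order in the step, whereas the
  imbalance |U_1|^2 - |U_2|^2, which it must dominate while hiding, shrinks only to second order.
  This comparison needs small steps, and they come from a second use of the curvature bound, along
  the ray through u_t. The step-size condition speaks of a ball of radius eta_t * |grad|. A
  pointwise curvature bound can be read off only if the gradient is nonzero, which convergence of
  the loss to 0 enforces. The constant kappa is the limit of |u_t| / S_t, where S_t sums eta_s *
  |z_s| * |u_s|^(L-1) over s < t. It is positive because the limiting residual direction has
  positive inner product with the limiting predictor.\<close>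

definition wave :: "nat \<Rightarrow> nat \<Rightarrow> nat \<Rightarrow> complex" where
  "wave D p d = cis (2 * pi * real p * real d / real D)"

lemma wave_commute: "wave D p d = wave D d p"
  by (simp add: wave_def mult_ac)

lemma wave_power: "wave D p d = wave D p 1 ^ d"
  by (simp add: wave_def Complex.DeMoivre mult_ac)

lemma norm_wave [simp]: "cmod (wave D p d) = 1"
  by (simp add: wave_def)

text \<open>The cosine of the angle difference is 1, so \<open>D\<close> divides
  \<open>p - q\<close>; the range bounds leave only zero.\<close>

lemma wave_eq_1_cancel:
  assumes "p < D" "q < D" "wave D p 1 * cnj (wave D q 1) = 1"
  shows "p = q"
proof -
  have "cis (2 * pi * (real p - real q) / real D) = 1"
    using assms(3) by (simp add: wave_def cis_cnj cis_mult diff_divide_distrib ring_distribs)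
  then have "Re (cis (2 * pi * (real p - real q) / real D)) = Re 1"
    by (rule arg_cong)
  then have "cos (2 * pi * (real p - real q) / real D) = 1"
    by simp
  then obtain k :: int where "2 * pi * (real p - real q) / real D = of_int k * 2 * pi"
    using cos_one_2pi_int by blast
  then have "2 * pi * (real p - real q) = 2 * pi * (of_int k * real D)"
    using assms by (simp add: field_simps)
  then have "real p - real q = of_int k * real D"
    by simp
  then have "real_of_int (int p - int q) = real_of_int (k * int D)"
    by simp
  then have *: "int p - int q = k * int D"
    by (rule of_int_eq_iff[THEN iffD1])
  have "\<bar>k\<bar> * int D < 1 * int D"
    using * assms abs_mult[of k "int D"] by linarith
  then have "\<bar>k\<bar> < 1"
    by (rule mult_right_less_imp_less) simp
  then have "k = 0" by simp
  then show ?thesis using * by simp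
qed

text \<open>A geometric sum whose ratio is a \<open>D\<close>-th root of unity, nontrivial unless
  \<open>p = q\<close> by \<open>wave_eq_1_cancel\<close>.\<close>

lemma wave_orthogonal:
  assumes "p < D" "q < D"
  shows "(\<Sum>d<D. wave D p d * cnj (wave D q d)) = (if p = q then of_nat D else 0)"
proof -
  define c where "c = wave D p 1 * cnj (wave D q 1)"
  have c: "wave D p d * cnj (wave D q d) = c ^ d" for d
    unfolding c_def by (simp add: wave_power[of D p d] wave_power[of D q d] power_mult_distrib)
  show ?thesis
  proof (cases "p = q")
    case True
    then have "c = 1" unfolding c_def by (simp add: complex_norm_square[symmetric])
    then show ?thesis using True c by simp
  next
    case False
    then have "c \<noteq> 1" using wave_eq_1_cancel[OF assms] unfolding c_def by argo
    moreover have "c ^ D = 1"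
    proof -
      have "wave D r D = 1" if "r < D" for r
        using that cis_multiple_2pi[of "real r"] by (simp add: wave_def)
      then show ?thesis using c[of D] assms by simp
    qed
    ultimately show ?thesis using False c geometric_sum[of c D] by simp
  qed
qed

lemma dft_wave: "dft D w d = (\<Sum>p<D. of_real (w p) * cnj (wave D p d)) / of_real (sqrt (real D))"
  by (simp add: dft_def wave_def cis_cnj of_real_divide)

text \<open>Complex \<open>f\<close> and no \<open>sqrt D\<close> factors, so that it serves both
  directions: \<open>dft_inversion\<close> for real vectors and \<open>dft_eqI\<close> for complex
  spectra.\<close>

lemma sum_wave_inverse:
  assumes "k < D"
  shows "(\<Sum>d<D. (\<Sum>p<D. f p * cnj (wave D p d)) * wave D k d) = of_nat D * f k"
proof -
  have "(\<Sum>d<D. (\<Sum>p<D. f p * cnj (wave D p d)) * wave D k d)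
      = (\<Sum>p<D. f p * (\<Sum>d<D. wave D k d * cnj (wave D p d)))"
    unfolding sum_distrib_right sum_distrib_left by (subst sum.swap) (simp add: mult_ac)
  also have "\<dots> = (\<Sum>p<D. if p = k then of_nat D * f k else 0)"
    using assms by (intro sum.cong) (auto simp: wave_orthogonal)
  finally show ?thesis using assms by simp
qed

lemma of_real_sqrt_mult_self: "complex_of_real (sqrt (real D)) * of_real (sqrt (real D)) = of_nat D"
  by (simp flip: of_real_mult)

text \<open>Recognizes a spectrum from its synthesis formula. Hermitian symmetry of \<open>F\<close>
  is encoded in the premise, whose left side is real.\<close>

lemma dft_eqI:
  assumes "d < D"
    and "\<And>k. k < D \<Longrightarrow> of_real (v k) = (\<Sum>e<D. F e * wave D k e) / of_real (sqrt (real D))"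
  shows "dft D v d = F d"
proof -
  have "dft D v d = (\<Sum>p<D. (\<Sum>e<D. F e * wave D p e) * cnj (wave D p d)) / of_nat D"
    unfolding dft_wave using assms(2)
    by (simp add: sum_divide_distrib[symmetric] of_real_sqrt_mult_self)
  \<comment> \<open>Conjugation and the symmetry of \<open>wave\<close> exchange time and frequency,
    which brings the double sum into the form of \<open>sum_wave_inverse\<close>.\<close>
  also have "(\<Sum>p<D. (\<Sum>e<D. F e * wave D p e) * cnj (wave D p d))
     = cnj (\<Sum>p<D. (\<Sum>e<D. cnj (F e) * cnj (wave D e p)) * wave D d p)"
    by (simp add: wave_commute)
  also have "\<dots> = of_nat D * F d"
    by (simp add: sum_wave_inverse[OF assms(1), of "\<lambda>e. cnj (F e)"])
  finally show ?thesis using assms(1) by simp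
qed

lemma dft_inversion:
  assumes "k < D"
  shows "of_real (w k) = (\<Sum>d<D. dft D w d * wave D k d) / of_real (sqrt (real D))"
  using sum_wave_inverse[OF assms, of "\<lambda>p. of_real (w p)"] assms
  by (simp add: dft_wave sum_divide_distrib[symmetric] of_real_sqrt_mult_self divide_divide_eq_left)

lemma parseval:
  "of_real (inner_D D a b) = (\<Sum>d<D. dft D a d * cnj (dft D b d))"
proof -
  have "of_real (inner_D D a b) = (\<Sum>k<D. of_real (a k) * of_real (b k) :: complex)"
    by (simp add: inner_D_def)
  also have "\<dots> = (\<Sum>k<D. (\<Sum>d<D. dft D a d * wave D k d) / of_real (sqrt (real D)) * of_real (b k))"
    by (simp add: dft_inversion)
  also have "\<dots> = (\<Sum>k<D. \<Sum>d<D. dft D a d * (of_real (b k) * wave D k d) / of_real (sqrt (real D)))"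
    by (simp add: sum_distrib_left sum_distrib_right sum_divide_distrib mult_ac)
  also have "\<dots> = (\<Sum>d<D. dft D a d * cnj (dft D b d))"
    by (subst sum.swap) (simp add: dft_wave sum_distrib_left sum_divide_distrib)
  finally show ?thesis .
qed

lemma inner_dft: "inner_D D a b = (\<Sum>d<D. Re (dft D a d * cnj (dft D b d)))"
proof -
  have "inner_D D a b = Re (of_real (inner_D D a b))"
    by simp
  then show ?thesis
    unfolding parseval by simp
qed

section \<open>The network and its gradient in the Fourier domain\<close>

lemma wave_add: "wave D (p + q) d = wave D p d * wave D q d"
  by (simp add: wave_def cis_mult add_divide_distrib ring_distribs)

lemma wave_mod: "wave D (p mod D) d = wave D p d"
proof (cases "D = 0")
  case False
  have "wave D (D * (p div D)) d = 1"
    using False cis_multiple_2pi[of "real (p div D * d)"] by (simp add: wave_def mult_ac)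
  then show ?thesis
    using wave_add[of D "D * (p div D)" "p mod D" d] by simp
qed simp

lemma dft_cong: "(\<And>k. k < D \<Longrightarrow> a k = b k) \<Longrightarrow> dft D a d = dft D b d"
  by (simp add: dft_def)

lemma dft_add_scale: "dft D (\<lambda>k. a k + s * b k) d = dft D a d + of_real s * dft D b d"
  by (simp add: dft_wave sum.distrib ring_distribs sum_distrib_left add_divide_distrib
      mult.assoc)

lemma dft_scale: "dft D (\<lambda>k. s * b k) d = of_real s * dft D b d"
  by (simp add: dft_wave sum_distrib_left mult.assoc)

lemma dft_lincomb: "dft D (\<lambda>k. \<Sum>n\<in>A. c n * a n k) d = (\<Sum>n\<in>A. of_real (c n) * dft D (a n) d)"
  unfolding dft_wave sum_divide_distrib[symmetric] of_real_sum sum_distrib_right times_divide_eq_right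
    sum_distrib_left
  by (subst sum.swap) (simp add: mult.assoc)

lemma dft_unit:
  assumes "k < D"
  shows "dft D (\<lambda>j. if j = k then 1 else 0) d = cnj (wave D k d) / of_real (sqrt (real D))"
proof -
  have "(\<Sum>p<D. of_real (if p = k then 1 else 0) * cnj (wave D p d)) =
     (\<Sum>p<D. if p = k then cnj (wave D k d) else 0)"
    by (intro sum.cong) auto
  then show ?thesis using assms by (simp add: dft_wave)
qed

text \<open>The index \<open>(d + k) mod D\<close> makes this a correlation, hence the conjugate on
  the second factor; the \<open>1 / sqrt D\<close> in \<open>circ_conv\<close> absorbs the
  normalization of the transform.\<close>

lemma dft_circ_conv:
  assumes "d < D"
  shows "dft D (circ_conv D h v) d = dft D h d * cnj (dft D v d)"
proof (rule dft_eqI[OF assms])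
  fix k assume "k < D"
  let ?s = "complex_of_real (sqrt (real D))"
  have h: "of_real (h ((k + j) mod D)) = (\<Sum>e<D. dft D h e * (wave D k e * wave D j e)) / ?s" for j
    using \<open>k < D\<close> dft_inversion[of "(k + j) mod D" D h] by (simp add: wave_mod wave_add)
  have v: "cnj (dft D v e) = (\<Sum>j<D. of_real (v j) * wave D j e) / ?s" for e
    by (simp add: dft_wave)
  have "complex_of_real (circ_conv D h v k) = (\<Sum>j<D. of_real (v j) * of_real (h ((k + j) mod D))) / ?s"
    by (simp add: circ_conv_def of_real_divide)
  also have "\<dots> = (\<Sum>j<D. \<Sum>e<D. dft D h e * ((of_real (v j) * wave D j e) / ?s) * wave D k e) / ?s"
    unfolding h by (simp add: sum_distrib_left sum_divide_distrib mult_ac)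
  also have "\<dots> = (\<Sum>e<D. dft D h e * cnj (dft D v e) * wave D k e) / ?s"
    unfolding v by (subst sum.swap)
      (simp add: sum_distrib_left sum_distrib_right sum_divide_distrib mult_ac)
  finally show "complex_of_real (circ_conv D h v k)
      = (\<Sum>e<D. dft D h e * cnj (dft D v e) * wave D k e) / ?s" .
qed

lemma dft_conv_chain:
  assumes "d < D"
  shows "dft D (conv_chain D u x l) d = dft D x d * cnj (\<Prod>j\<in>{1..l}. dft D (u j) d)"
  by (induction l) (simp_all add: dft_circ_conv[OF assms] mult_ac)

lemma lin_conv_net_dft:
  assumes "L \<ge> 1"
  shows "of_real (lin_conv_net D L u x)
    = (\<Sum>d<D. dft D x d * cnj (\<Prod>j\<in>{1..L}. dft D (u j) d))"
proof -
  obtain M where M: "L = Suc M" using assms by (cases L) auto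
  have "of_real (lin_conv_net D L u x) = (\<Sum>d<D. dft D (conv_chain D u x M) d * cnj (dft D (u L) d))"
    by (simp add: lin_conv_net_def parseval M)
  also have "\<dots> = (\<Sum>d<D. dft D x d * cnj (\<Prod>j\<in>{1..L}. dft D (u j) d))"
    by (intro sum.cong) (simp_all add: dft_conv_chain M mult_ac)
  finally show ?thesis .
qed

lemma dft_P_conv:
  assumes "L \<ge> 1" "d < D"
  shows "dft D (P_conv D L u) d = (\<Prod>j\<in>{1..L}. dft D (u j) d)"
proof (rule dft_eqI[OF assms(2)])
  fix k assume k: "k < D"
  have "complex_of_real (P_conv D L u k)
     = (\<Sum>d<D. cnj (wave D k d) / of_real (sqrt (real D)) * cnj (\<Prod>j\<in>{1..L}. dft D (u j) d))"
    unfolding dft_unit[OF k, symmetric] lin_conv_net_dft[OF assms(1), symmetric]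
    using k by (simp add: P_conv_def)
  \<comment> \<open>\<open>P_conv\<close> is real, so the identity may be conjugated; this removes
    the conjugates accumulated through the layers.\<close>
  then have "complex_of_real (P_conv D L u k)
     = cnj (\<Sum>d<D. cnj (wave D k d) / of_real (sqrt (real D)) * cnj (\<Prod>j\<in>{1..L}. dft D (u j) d))"
    by (metis complex_cnj_complex_of_real)
  then show "complex_of_real (P_conv D L u k)
     = (\<Sum>d<D. (\<Prod>j\<in>{1..L}. dft D (u j) d) * wave D k d) / of_real (sqrt (real D))"
    by (simp add: sum_divide_distrib mult_ac)
qed

lemma inner_P_conv:
  assumes "L \<ge> 1"
  shows "of_real (inner_D D x (P_conv D L u))
    = (\<Sum>d<D. dft D x d * cnj (\<Prod>j\<in>{1..L}. dft D (u j) d))"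
  by (simp add: parseval dft_P_conv[OF assms])

text \<open>The prediction is linear in each layer separately; with layer \<open>l\<close> isolated,
  derivatives with respect to it can be read off.\<close>

lemma inner_P_conv_upd:
  assumes "l \<in> {1..L}"
  shows "of_real (inner_D D x (P_conv D L (u(l := v))))
    = (\<Sum>d<D. dft D x d * cnj (dft D v d) * cnj (\<Prod>j\<in>{1..L} - {l}. dft D (u j) d))"
proof -
  have "(\<Prod>j\<in>{1..L}. dft D ((u(l := v)) j) d) = dft D v d * (\<Prod>j\<in>{1..L} - {l}. dft D (u j) d)" for d
    using assms by (subst prod.remove[of _ l]) auto
  then show ?thesis
    using assms by (subst inner_P_conv) (auto simp: mult_ac)
qed

text \<open>The sign makes the residual a nonnegative combination of the vectors
  \<open>y n * x n\<close>; its normalized coefficients later become the dual variables.\<close>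

definition neg_grad :: "nat \<Rightarrow> nat \<Rightarrow> (nat \<Rightarrow> nat \<Rightarrow> real) \<Rightarrow> (nat \<Rightarrow> real) \<Rightarrow> (nat \<Rightarrow> real) \<Rightarrow> nat \<Rightarrow> real"
  where "neg_grad D N x y w = (\<lambda>k. \<Sum>n<N. (exp (- y n * inner_D D (x n) w) * y n) * x n k)"

lemma inner_D_upd:
  assumes "k < D"
  shows "inner_D D a (w(k := s)) = inner_D D a w + (s - w k) * a k"
proof -
  have "inner_D D a (w(k := s)) = (\<Sum>j<D. a j * w j + (if j = k then (s - w k) * a k else 0))"
    unfolding inner_D_def by (intro sum.cong) (auto simp: algebra_simps)
  then show ?thesis using assms by (simp add: sum.distrib inner_D_def)
qed

lemma grad_w_eq:
  assumes "k < D"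
  shows "grad_w D N x y w k = - neg_grad D N x y w k"
proof -
  have "((\<lambda>s. \<Sum>n<N. exp (- y n * (inner_D D (x n) w + (s - w k) * x n k)))
      has_real_derivative - neg_grad D N x y w k) (at (w k))"
    unfolding neg_grad_def
    by (auto intro!: derivative_eq_intros simp: sum_negf[symmetric] mult_ac)
  then show ?thesis
    unfolding grad_w_def exp_loss_def
    by (auto simp: inner_D_upd[OF assms] intro: DERIV_imp_deriv)
qed

lemma inner_neg_grad:
  "inner_D D (neg_grad D N x y w) v = (\<Sum>n<N. exp (- y n * inner_D D (x n) w) * y n * inner_D D (x n) v)"
  unfolding neg_grad_def inner_D_def sum_distrib_right sum_distrib_left
  by (subst sum.swap) (simp add: mult.assoc)

lemma dft_neg_grad:
  "dft D (neg_grad D N x y w) d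
    = (\<Sum>n<N. of_real (exp (- y n * inner_D D (x n) w) * y n) * dft D (x n) d)"
  unfolding neg_grad_def by (rule dft_lincomb)

text \<open>Each prediction is affine in a single weight, with slope the prediction of the network
  whose layer \<open>l\<close> is the \<open>k\<close>-th unit vector.\<close>

lemma grad_params_eq:
  assumes l: "l \<in> {1..L}" and k: "k < D"
  shows "grad_params D L N x y u l k = - inner_D D (neg_grad D N x y (P_conv D L u))
     (P_conv D L (u(l := (\<lambda>j. if j = k then 1 else 0))))"
proof -
  let ?e = "\<lambda>j. if j = k then 1 else (0::real)"
  have upd: "(u l)(k := s) = (\<lambda>j. u l j + (s - u l k) * ?e j)" for s
    by (auto simp: fun_eq_iff)
  have "complex_of_real (inner_D D a (P_conv D L (u(l := (u l)(k := s)))))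
     = of_real (inner_D D a (P_conv D L u) + (s - u l k) * inner_D D a (P_conv D L (u(l := ?e))))"
    for a s
  proof -
    have "of_real (inner_D D a (P_conv D L u)) =
       (\<Sum>d<D. dft D a d * cnj (dft D (u l) d) * cnj (\<Prod>j\<in>{1..L} - {l}. dft D (u j) d))"
      using inner_P_conv_upd[OF l, of D a u "u l"] by simp
    then show ?thesis
      unfolding of_real_add of_real_mult inner_P_conv_upd[OF l] upd dft_add_scale
      by (simp only: sum_distrib_left sum.distrib[symmetric])
        (rule sum.cong, simp_all add: algebra_simps)
  qed
  then have inner: "inner_D D a (P_conv D L (u(l := (u l)(k := s))))
     = inner_D D a (P_conv D L u) + (s - u l k) * inner_D D a (P_conv D L (u(l := ?e)))" for a s
    by (simp only: of_real_eq_iff)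
  have "((\<lambda>s. conv_loss D L N x y (u(l := (u l)(k := s)))) has_real_derivative
     - inner_D D (neg_grad D N x y (P_conv D L u)) (P_conv D L (u(l := ?e)))) (at (u l k))"
    unfolding conv_loss_def exp_loss_def inner inner_neg_grad
    by (auto intro!: derivative_eq_intros simp: sum_negf[symmetric] mult_ac)
  then show ?thesis
    unfolding grad_params_def by (rule DERIV_imp_deriv)
qed

lemma dft_grad_params:
  assumes l: "l \<in> {1..L}" and d: "d < D"
  shows "dft D (grad_params D L N x y u l) d
    = - dft D (neg_grad D N x y (P_conv D L u)) d * cnj (\<Prod>j\<in>{1..L} - {l}. dft D (u j) d)"
proof (rule dft_eqI[OF d])
  fix k assume k: "k < D"
  show "complex_of_real (grad_params D L N x y u l k) = (\<Sum>e<D. - dft D (neg_grad D N x y (P_conv D L u)) e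
     * cnj (\<Prod>j\<in>{1..L} - {l}. dft D (u j) e) * wave D k e) / of_real (sqrt (real D))"
    unfolding grad_params_eq[OF l k] of_real_minus inner_P_conv_upd[OF l] dft_unit[OF k]
    by (simp add: sum_negf sum_divide_distrib mult_ac)
qed

section \<open>Curvature bounds implied by the step-size condition\<close>

text \<open>Product rule over the layers, carried out on the spectra; each summand replaces one
  layer by its direction of motion.\<close>

lemma inner_P_conv_line_deriv:
  assumes L: "L \<ge> 1"
  shows "((\<lambda>s. inner_D D a (P_conv D L (\<lambda>l k. u l k + s * e l k))) has_real_derivative
    (\<Sum>l\<in>{1..L}. inner_D D a (P_conv D L ((\<lambda>l k. u l k + s * e l k)(l := e l))))) (at s)"
proof -
  let ?U = "\<lambda>s j d. dft D (u j) d + complex_of_real s * dft D (e j) d"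
  have 1: "inner_D D a (P_conv D L (\<lambda>l k. u l k + s * e l k))
     = Re (\<Sum>d<D. dft D a d * cnj (\<Prod>j\<in>{1..L}. ?U s j d))" for s
    using arg_cong[OF inner_P_conv[OF L, of D a "\<lambda>l k. u l k + s * e l k"], of Re]
    unfolding dft_add_scale by simp
  have 2: "inner_D D a (P_conv D L ((\<lambda>l k. u l k + s * e l k)(l := e l)))
     = Re (\<Sum>d<D. dft D a d * cnj (dft D (e l) d) * cnj (\<Prod>j\<in>{1..L} - {l}. ?U s j d))"
    if "l \<in> {1..L}" for l s
    using arg_cong[OF inner_P_conv_upd[OF that, of D a "\<lambda>l k. u l k + s * e l k" "e l"], of Re]
    unfolding dft_add_scale by simp
  have 3: "((\<lambda>s. \<Prod>j\<in>{1..L}. ?U s j d) has_derivative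
     (\<lambda>h. \<Sum>l\<in>{1..L}. (of_real h * dft D (e l) d) * (\<Prod>j\<in>{1..L} - {l}. ?U s j d))) (at s)" for d
    by (rule has_derivative_prod) (auto intro!: derivative_eq_intros)
  have "((\<lambda>s. Re (\<Sum>d<D. dft D a d * cnj (\<Prod>j\<in>{1..L}. ?U s j d))) has_derivative
     (\<lambda>h. Re (\<Sum>d<D. dft D a d * cnj (\<Sum>l\<in>{1..L}. (of_real h * dft D (e l) d)
        * (\<Prod>j\<in>{1..L} - {l}. ?U s j d))))) (at s)"
    by (intro bounded_linear.has_derivative[OF bounded_linear_Re] has_derivative_sum
        has_derivative_mult_right bounded_linear.has_derivative[OF bounded_linear_cnj] 3)
  moreover have "Re (\<Sum>d<D. dft D a d * cnj (\<Sum>l\<in>{1..L}. (of_real h * dft D (e l) d)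
        * (\<Prod>j\<in>{1..L} - {l}. ?U s j d)))
     = (\<Sum>l\<in>{1..L}. inner_D D a (P_conv D L ((\<lambda>l k. u l k + s * e l k)(l := e l)))) * h" for h
  proof -
    have "(\<Sum>d<D. dft D a d * cnj (\<Sum>l\<in>{1..L}. (of_real h * dft D (e l) d)
        * (\<Prod>j\<in>{1..L} - {l}. ?U s j d))) = of_real h *
        (\<Sum>l\<in>{1..L}. \<Sum>d<D. dft D a d * cnj (dft D (e l) d) * cnj (\<Prod>j\<in>{1..L} - {l}. ?U s j d))"
      unfolding cnj_sum sum_distrib_left by (subst sum.swap) (simp add: mult_ac)
    then show ?thesis
      using 2 by (simp only: Re_sum Re_complex_of_real Im_complex_of_real times_complex.sel) simp
  qed
  ultimately show ?thesis
    unfolding 1 has_field_derivative_def by (simp only:)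
qed

lemma inner_grad_params:
  assumes "l \<in> {1..L}"
  shows "inner_D D (grad_params D L N x y u l) v
    = - inner_D D (neg_grad D N x y (P_conv D L u)) (P_conv D L (u(l := v)))"
proof -
  have "complex_of_real (inner_D D (grad_params D L N x y u l) v)
    = of_real (- inner_D D (neg_grad D N x y (P_conv D L u)) (P_conv D L (u(l := v))))"
    unfolding of_real_minus inner_P_conv_upd[OF assms]
    by (simp add: parseval dft_grad_params[OF assms] sum_negf mult_ac)
  then show ?thesis by (simp only: of_real_eq_iff)
qed

lemma pnorm_L2_set: "pnorm D L u = L2_set (\<lambda>(l, k). u l k) ({1..L} \<times> {..<D})"
  by (simp add: pnorm_def L2_set_def sum.cartesian_product case_prod_unfold)

lemma inner_le_pnorm: "(\<Sum>l\<in>{1..L}. inner_D D (g l) (e l)) \<le> pnorm D L g * pnorm D L e"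
proof -
  have "(\<Sum>l\<in>{1..L}. inner_D D (g l) (e l)) = (\<Sum>p\<in>{1..L} \<times> {..<D}. (case p of (l, k) \<Rightarrow> g l k) * (case p of (l, k) \<Rightarrow> e l k))"
    by (simp add: inner_D_def sum.cartesian_product case_prod_unfold)
  also have "\<dots> \<le> (\<Sum>p\<in>{1..L} \<times> {..<D}. \<bar>case p of (l, k) \<Rightarrow> g l k\<bar> * \<bar>case p of (l, k) \<Rightarrow> e l k\<bar>)"
    by (intro sum_mono) (metis abs_ge_self abs_mult)
  also have "\<dots> \<le> pnorm D L g * pnorm D L e"
    unfolding pnorm_L2_set by (rule L2_set_mult_ineq)
  finally show ?thesis .
qed

lemma pnorm_nonneg [simp]: "0 \<le> pnorm D L u"
  by (simp add: pnorm_L2_set L2_set_nonneg)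

lemma pnorm_scale: "pnorm D L (\<lambda>l k. c * u l k) = \<bar>c\<bar> * pnorm D L u"
  by (simp add: pnorm_def power_mult_distrib sum_distrib_left[symmetric] real_sqrt_mult)

text \<open>The Lipschitz clause of \<open>step_size_ok\<close> with a free radius: for second
  derivatives at \<open>u\<close> only positivity of the radius matters.\<close>

definition local_lipschitz_grad ::
  "nat \<Rightarrow> nat \<Rightarrow> nat \<Rightarrow> (nat \<Rightarrow> nat \<Rightarrow> real) \<Rightarrow> (nat \<Rightarrow> real) \<Rightarrow> (nat \<Rightarrow> nat \<Rightarrow> real) \<Rightarrow> real \<Rightarrow> real \<Rightarrow> bool"
  where "local_lipschitz_grad D L N x y u r \<beta> \<longleftrightarrow>
     (\<forall>v v'. pdist D L v u \<le> r \<longrightarrow> pdist D L v' u \<le> r \<longrightarrow>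
        pdist D L (grad_params D L N x y v) (grad_params D L N x y v') \<le> \<beta> * pdist D L v v')"

text \<open>Cauchy-Schwarz bounds the difference quotients of the gradient paired with
  \<open>e\<close>; the limit from the right then gives the claim.\<close>

lemma lipschitz_second_derivative:
  assumes lip: "local_lipschitz_grad D L N x y u r \<beta>" and r: "r > 0"
    and der: "((\<lambda>s. \<Sum>l\<in>{1..L}. inner_D D (grad_params D L N x y (\<lambda>l k. u l k + s * e l k) l) (e l))
        has_real_derivative D') (at 0)"
  shows "D' \<le> \<beta> * (pnorm D L e)\<^sup>2"
proof -
  define \<psi> where "\<psi> s = (\<Sum>l\<in>{1..L}. inner_D D (grad_params D L N x y (\<lambda>l k. u l k + s * e l k) l) (e l))" for s
  \<comment> \<open>The \<open>+ 1\<close> keeps \<open>\<delta>\<close> positive when the direction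
    has norm zero.\<close>
  define \<delta> where "\<delta> = r / (pnorm D L e + 1)"
  have "pnorm D L e + 1 > 0" by (simp add: add_nonneg_pos)
  then have \<delta>: "\<delta> > 0" using r by (simp add: \<delta>_def)
  have bound: "(\<psi> s - \<psi> 0) / s \<le> \<beta> * (pnorm D L e)\<^sup>2" if s: "0 < s" "s < \<delta>" for s
  proof -
    let ?v = "\<lambda>l k. u l k + s * e l k"
    have dist: "pdist D L ?v u = s * pnorm D L e"
      using s by (simp add: pdist_def pnorm_scale)
    have "s * pnorm D L e \<le> s * (pnorm D L e + 1)" using s by simp
    also have "\<dots> \<le> r" using s \<open>pnorm D L e + 1 > 0\<close> by (simp add: \<delta>_def pos_less_divide_eq)
    finally have "pdist D L ?v u \<le> r" by (simp add: dist)
    moreover have "pdist D L u u \<le> r" using r by (simp add: pdist_def pnorm_def)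
    ultimately have g: "pdist D L (grad_params D L N x y ?v) (grad_params D L N x y u) \<le> \<beta> * (s * pnorm D L e)"
      using lip unfolding local_lipschitz_grad_def dist[symmetric] by blast
    have "\<psi> s - \<psi> 0 = (\<Sum>l\<in>{1..L}. inner_D D (\<lambda>k. grad_params D L N x y ?v l k - grad_params D L N x y u l k) (e l))"
      by (simp add: \<psi>_def inner_D_def left_diff_distrib sum_subtractf)
    also have "\<dots> \<le> pdist D L (grad_params D L N x y ?v) (grad_params D L N x y u) * pnorm D L e"
      unfolding pdist_def by (rule inner_le_pnorm)
    also have "\<dots> \<le> \<beta> * (s * pnorm D L e) * pnorm D L e"
      by (intro mult_right_mono g) simp
    finally show ?thesis using s by (simp add: pos_divide_le_eq power2_eq_square mult_ac)
  qed
  have "((\<lambda>s. (\<psi> s - \<psi> 0) / s) \<longlongrightarrow> D') (at 0)"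
    using der unfolding \<psi>_def[symmetric] by (simp add: DERIV_def)
  then have lim: "((\<lambda>s. (\<psi> s - \<psi> 0) / s) \<longlongrightarrow> D') (at_right 0)"
    by (rule filterlim_mono) (simp_all add: at_le)
  have "eventually (\<lambda>s. (\<psi> s - \<psi> 0) / s \<le> \<beta> * (pnorm D L e)\<^sup>2) (at_right 0)"
    using bound \<delta> unfolding eventually_at_right_field by blast
  with lim show ?thesis by (rule tendsto_upperbound) simp
qed

text \<open>The left side is the second derivative of the loss along the line. The caller supplies a
  closed form \<open>Q\<close> of the predictions; uniqueness of derivatives matches
  \<open>Qd\<close> with the gradient paired with \<open>e\<close>.\<close>

lemma lipschitz_bounds_curvature:
  assumes lip: "local_lipschitz_grad D L N x y u r \<beta>" and r: "r > 0" and L: "L \<ge> 1"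
    and y: "\<And>n. n < N \<Longrightarrow> (y n)\<^sup>2 = 1"
    and Q: "\<And>n s. n < N \<Longrightarrow> inner_D D (x n) (P_conv D L (\<lambda>l k. u l k + s * e l k)) = Q n s"
    and Qd: "\<And>n s. n < N \<Longrightarrow> (Q n has_real_derivative Qd n s) (at s)"
    and Qdd: "\<And>n. n < N \<Longrightarrow> (Qd n has_real_derivative Qdd n) (at 0)"
  shows "(\<Sum>n<N. exp (- y n * Q n 0) * ((Qd n 0)\<^sup>2 - y n * Qdd n)) \<le> \<beta> * (pnorm D L e)\<^sup>2"
proof (rule lipschitz_second_derivative[OF lip r])
  have Qd': "(\<Sum>l\<in>{1..L}. inner_D D (x n) (P_conv D L ((\<lambda>l k. u l k + s * e l k)(l := e l)))) = Qd n s"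
    if n: "n < N" for n s
    using inner_P_conv_line_deriv[OF L, of D "x n" u e s] Qd[OF n, of s] unfolding Q[OF n]
    by (rule DERIV_unique)
  have "(\<Sum>l\<in>{1..L}. inner_D D (grad_params D L N x y (\<lambda>l k. u l k + s * e l k) l) (e l))
    = - (\<Sum>n<N. exp (- y n * Q n s) * y n * Qd n s)" for s
  proof -
    have "(\<Sum>l\<in>{1..L}. inner_D D (grad_params D L N x y (\<lambda>l k. u l k + s * e l k) l) (e l))
      = - (\<Sum>l\<in>{1..L}. \<Sum>n<N. exp (- y n * Q n s) * y n *
          inner_D D (x n) (P_conv D L ((\<lambda>l k. u l k + s * e l k)(l := e l))))"
      by (simp add: inner_grad_params inner_neg_grad Q sum_negf)
    also have "\<dots> = - (\<Sum>n<N. exp (- y n * Q n s) * y n *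
        (\<Sum>l\<in>{1..L}. inner_D D (x n) (P_conv D L ((\<lambda>l k. u l k + s * e l k)(l := e l)))))"
      by (subst sum.swap) (simp only: sum_distrib_left)
    also have "\<dots> = - (\<Sum>n<N. exp (- y n * Q n s) * y n * Qd n s)"
      by (intro arg_cong[of _ _ uminus] sum.cong arg_cong2[of _ _ _ _ "(*)"] refl Qd') simp
    finally show ?thesis .
  qed
  moreover have "((\<lambda>s. - (\<Sum>n<N. exp (- y n * Q n s) * y n * Qd n s)) has_real_derivative
     (\<Sum>n<N. exp (- y n * Q n 0) * ((Qd n 0)\<^sup>2 - y n * Qdd n))) (at 0)"
  proof -
    have "((\<lambda>s. exp (- y n * Q n s) * y n * Qd n s) has_real_derivative
     - (exp (- y n * Q n 0) * ((Qd n 0)\<^sup>2 - y n * Qdd n))) (at 0)" if n: "n < N" for n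
      using y[OF n]
      by (auto intro!: derivative_eq_intros Qd[OF n] Qdd[OF n] simp: algebra_simps power2_eq_square)
    then have "((\<lambda>s. - (\<Sum>n<N. exp (- y n * Q n s) * y n * Qd n s)) has_real_derivative
      - (\<Sum>n<N. - (exp (- y n * Q n 0) * ((Qd n 0)\<^sup>2 - y n * Qdd n)))) (at 0)"
      by (intro DERIV_minus DERIV_sum) simp
    then show ?thesis by (simp add: sum_negf)
  qed
  ultimately show "((\<lambda>s. \<Sum>l\<in>{1..L}. inner_D D (grad_params D L N x y (\<lambda>l k. u l k + s * e l k) l) (e l))
        has_real_derivative (\<Sum>n<N. exp (- y n * Q n 0) * ((Qd n 0)\<^sup>2 - y n * Qdd n))) (at 0)"
    by simp
qed

lemma inner_P_conv_upd2:
  assumes l: "l \<in> {1..L}" and k: "k \<in> {1..L}" and "l \<noteq> k"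
  shows "of_real (inner_D D x (P_conv D L (u(l := a, k := b))))
    = (\<Sum>d<D. dft D x d * cnj (dft D a d * dft D b d * (\<Prod>j\<in>{1..L} - {l, k}. dft D (u j) d)))"
proof -
  have "{1..L} - {k} - {l} = {1..L} - {l, k}" by auto
  then have "(\<Prod>j\<in>{1..L} - {k}. dft D ((u(l := a)) j) d) = dft D a d * (\<Prod>j\<in>{1..L} - {l, k}. dft D (u j) d)" for d
    using assms by (subst prod.remove[of _ l]) auto
  then show ?thesis
    unfolding inner_P_conv_upd[OF k] by (simp add: mult_ac)
qed

lemma P_conv_line2:
  assumes l: "l \<in> {1..L}" and k: "k \<in> {1..L}" and lk: "l \<noteq> k"
  shows "inner_D D x (P_conv D L (\<lambda>j i. u j i + s * ((\<lambda>j i. 0)(l := a, k := b)) j i))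
   = inner_D D x (P_conv D L u) + s * (inner_D D x (P_conv D L (u(l := a)))
       + inner_D D x (P_conv D L (u(k := b)))) + s\<^sup>2 * inner_D D x (P_conv D L (u(l := a, k := b)))"
proof -
  let ?R = "\<lambda>d. \<Prod>j\<in>{1..L} - {l, k}. dft D (u j) d"
  have eq: "(\<lambda>j i. u j i + s * ((\<lambda>j i. 0)(l := a, k := b)) j i)
     = u(l := (\<lambda>i. u l i + s * a i), k := (\<lambda>i. u k i + s * b i))"
    using lk by (auto simp: fun_eq_iff)
  note upd2 = inner_P_conv_upd2[OF l k lk]
  have 0: "P_conv D L u = P_conv D L (u(l := u l, k := u k))" by simp
  have 1: "P_conv D L (u(l := a)) = P_conv D L (u(l := a, k := u k))"
    by (rule arg_cong[of _ _ "P_conv D L"]) (use lk in \<open>auto simp: fun_eq_iff\<close>)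
  have 2: "P_conv D L (u(k := b)) = P_conv D L (u(l := u l, k := b))"
    by (rule arg_cong[of _ _ "P_conv D L"]) (use lk in \<open>auto simp: fun_eq_iff\<close>)
  have "complex_of_real (inner_D D x (P_conv D L (\<lambda>j i. u j i + s * ((\<lambda>j i. 0)(l := a, k := b)) j i)))
   = of_real (inner_D D x (P_conv D L u) + s * (inner_D D x (P_conv D L (u(l := a)))
       + inner_D D x (P_conv D L (u(k := b)))) + s\<^sup>2 * inner_D D x (P_conv D L (u(l := a, k := b))))"
    unfolding eq 0 1 2 of_real_add of_real_mult upd2 dft_add_scale sum_distrib_left sum.distrib[symmetric]
    by (rule sum.cong) (simp_all add: algebra_simps power2_eq_square)
  then show ?thesis by (simp only: of_real_eq_iff)
qed

text \<open>Moving two layers makes the predictions quadratic in \<open>s\<close>. The squared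
  first-order terms enter with positive sign and are dropped, which leaves the mixed term paired
  with the residual.\<close>

lemma two_layer_curvature:
  assumes lip: "local_lipschitz_grad D L N x y u r \<beta>" and r: "r > 0"
    and y: "\<And>n. n < N \<Longrightarrow> (y n)\<^sup>2 = 1"
    and l: "l \<in> {1..L}" and k: "k \<in> {1..L}" and lk: "l \<noteq> k"
  shows "- 2 * inner_D D (neg_grad D N x y (P_conv D L u)) (P_conv D L (u(l := a, k := b)))
     \<le> \<beta> * (inner_D D a a + inner_D D b b)"
proof -
  let ?e = "(\<lambda>j i. 0)(l := a, k := b) :: nat \<Rightarrow> nat \<Rightarrow> real"
  define A where "A n = inner_D D (x n) (P_conv D L (u(l := a))) + inner_D D (x n) (P_conv D L (u(k := b)))" for n
  define B where "B n = inner_D D (x n) (P_conv D L (u(l := a, k := b)))" for n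
  have "pnorm D L ?e ^ 2 = (\<Sum>j\<in>{1..L}. inner_D D (?e j) (?e j))"
    by (simp add: pnorm_def inner_D_def power2_eq_square sum_nonneg)
  also have "\<dots> = (\<Sum>j\<in>{1..L}. (if j = l then inner_D D a a else 0) + (if j = k then inner_D D b b else 0))"
    using lk by (intro sum.cong) (auto simp: inner_D_def)
  also have "\<dots> = inner_D D a a + inner_D D b b"
    using l k by (simp add: sum.distrib)
  finally have e: "pnorm D L ?e ^ 2 = inner_D D a a + inner_D D b b" .
  have "(\<Sum>n<N. exp (- y n * inner_D D (x n) (P_conv D L u)) * ((A n)\<^sup>2 - y n * (2 * B n)))
    \<le> \<beta> * (pnorm D L ?e)\<^sup>2"
    using lipschitz_bounds_curvature[OF lip r, where e = ?e
        and Q = "\<lambda>n s. inner_D D (x n) (P_conv D L u) + s * A n + s\<^sup>2 * B n"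
        and Qd = "\<lambda>n s. A n + 2 * s * B n" and Qdd = "\<lambda>n. 2 * B n", OF _ y]
      l P_conv_line2[OF l k lk, of D _ u _ a b]
    by (force simp: A_def B_def intro!: derivative_eq_intros)
  moreover have "- 2 * inner_D D (neg_grad D N x y (P_conv D L u)) (P_conv D L (u(l := a, k := b)))
    \<le> (\<Sum>n<N. exp (- y n * inner_D D (x n) (P_conv D L u)) * ((A n)\<^sup>2 - y n * (2 * B n)))"
    unfolding inner_neg_grad B_def[symmetric] sum_distrib_left
    by (intro sum_mono) (simp add: algebra_simps)
  ultimately show ?thesis using e by simp
qed

text \<open>By orthogonality of the waves. The real and imaginary parts alone may also meet the
  mirror frequency \<open>D - d\<close>; the complex combination cancels it.\<close>

lemma dft_Re_Im_wave:
  assumes "d < D" "f < D"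
  shows "dft D (\<lambda>k. Re (c * wave D d k)) f + \<i> * dft D (\<lambda>k. Im (c * wave D d k)) f
    = (if f = d then c * of_real (sqrt (real D)) else 0)"
proof -
  let ?s = "complex_of_real (sqrt (real D))"
  have "dft D (\<lambda>k. Re (c * wave D d k)) f + \<i> * dft D (\<lambda>k. Im (c * wave D d k)) f
    = (\<Sum>k<D. (of_real (Re (c * wave D d k)) + \<i> * of_real (Im (c * wave D d k))) * cnj (wave D k f)) / ?s"
    unfolding dft_wave sum_distrib_left
    by (simp only: sum.distrib distrib_right add_divide_distrib times_divide_eq_right sum_distrib_left mult.assoc)
  also have "\<dots> = (\<Sum>k<D. c * (wave D d k * cnj (wave D f k))) / ?s"
    unfolding complex_eq[symmetric] by (simp add: wave_commute[of D f] mult.assoc)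
  also have "\<dots> = (if f = d then c * (of_nat D / ?s) else 0)"
    using assms by (simp add: wave_orthogonal flip: sum_distrib_left)
  also have "of_nat D / ?s = ?s"
    using assms of_real_sqrt_mult_self[of D] by (simp add: nonzero_divide_eq_eq)
  finally show ?thesis .
qed

text \<open>A real direction cannot isolate one frequency. The curvature form is bilinear in the two
  perturbed layers, so testing it on the real and on the imaginary parts of two complex waves and
  adding the results yields the complexified form, which can.\<close>
lemma mode_curvature:
  assumes lip: "local_lipschitz_grad D L N x y u r \<beta>" and r: "r > 0"
    and y: "\<And>n. n < N \<Longrightarrow> (y n)\<^sup>2 = 1"
    and l: "l \<in> {1..L}" and k: "k \<in> {1..L}" and lk: "l \<noteq> k" and d: "d < D"
  shows "cmod (dft D (neg_grad D N x y (P_conv D L u)) d) * (\<Prod>j\<in>{1..L} - {l, k}. cmod (dft D (u j) d)) \<le> \<beta>"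
proof -
  let ?s = "complex_of_real (sqrt (real D))"
  define z where "z = neg_grad D N x y (P_conv D L u)"
  define R where "R f = (\<Prod>j\<in>{1..L} - {l, k}. dft D (u j) f)" for f
  define \<zeta> where "\<zeta> = dft D z d * cnj (R d)"
  \<comment> \<open>Phase that makes the complexified form equal to
    \<open>- D * cmod \<zeta>\<close>, the sign for which \<open>two_layer_curvature\<close> is
    informative.\<close>
  define \<tau> where "\<tau> = - sgn \<zeta>"
  define a a' where "a = (\<lambda>k. Re (1 * wave D d k))" and "a' = (\<lambda>k. Im (1 * wave D d k))"
  define b b' where "b = (\<lambda>k. Re (\<tau> * wave D d k))" and "b' = (\<lambda>k. Im (\<tau> * wave D d k))"
  define Bil where "Bil a b = inner_D D z (P_conv D L (u(l := a, k := b)))" for a b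
  have Bil: "of_real (Bil a b) = (\<Sum>f<D. dft D z f * cnj (dft D a f * dft D b f * R f))" for a b
    unfolding Bil_def R_def by (rule inner_P_conv_upd2[OF l k lk])
  have "complex_of_real (Bil a b) - of_real (Bil a' b') - \<i> * (of_real (Bil a b') + of_real (Bil a' b))
    = (\<Sum>f<D. dft D z f * cnj ((dft D a f + \<i> * dft D a' f) * (dft D b f + \<i> * dft D b' f) * R f))"
    unfolding Bil sum_distrib_left sum.distrib[symmetric] sum_subtractf[symmetric]
    by (rule sum.cong) (simp_all add: algebra_simps)
  also have "\<dots> = (\<Sum>f<D. if f = d then of_nat D * cnj \<tau> * \<zeta> else 0)"
  proof (intro sum.cong refl)
    fix f assume "f \<in> {..<D}"
    then have "dft D a f + \<i> * dft D a' f = (if f = d then 1 * ?s else 0)"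
      "dft D b f + \<i> * dft D b' f = (if f = d then \<tau> * ?s else 0)"
      unfolding a_def a'_def b_def b'_def using dft_Re_Im_wave[OF d] by blast+
    moreover have "dft D z d * cnj (1 * ?s * (\<tau> * ?s) * R d) = (?s * ?s) * cnj \<tau> * \<zeta>"
      by (simp add: \<zeta>_def mult_ac)
    ultimately show "dft D z f * cnj ((dft D a f + \<i> * dft D a' f) * (dft D b f + \<i> * dft D b' f) * R f)
      = (if f = d then of_nat D * cnj \<tau> * \<zeta> else 0)"
      by (simp only: of_real_sqrt_mult_self) simp
  qed
  also have "\<dots> = of_nat D * cnj \<tau> * \<zeta>" using d by simp
  also have "\<dots> = of_real (- real D * cmod \<zeta>)"
  proof (cases "\<zeta> = 0")
    case False
    have "cnj (sgn \<zeta>) * \<zeta> = of_real (cmod \<zeta>)"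
      using False complex_norm_square[of \<zeta>]
      by (simp add: sgn_eq power2_eq_square field_simps)
    then show ?thesis by (simp add: \<tau>_def)
  qed simp
  finally have "Re (complex_of_real (Bil a b) - of_real (Bil a' b') - \<i> * (of_real (Bil a b') + of_real (Bil a' b)))
     = Re (of_real (- real D * cmod \<zeta>))" by (rule arg_cong)
  then have Bil_diff: "Bil a b - Bil a' b' = - real D * cmod \<zeta>" by simp
  \<comment> \<open>Flipping \<open>a'\<close> turns the difference
    \<open>Bil a b - Bil a' b'\<close> into a sum of two forms, so two curvature bounds can be
    added; the norms are unchanged.\<close>
  have neg: "Bil (\<lambda>k. - a' k) b' = - Bil a' b'"
  proof -
    have "dft D (\<lambda>k. - a' k) f = - dft D a' f" for f
      using dft_scale[of D "-1" a' f] by simp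
    then have "complex_of_real (Bil (\<lambda>k. - a' k) b') = of_real (- Bil a' b')"
      unfolding of_real_minus Bil by (simp add: sum_negf)
    then show ?thesis by (simp only: of_real_eq_iff)
  qed
  have \<tau>: "(cmod \<tau>)\<^sup>2 \<le> 1" by (simp add: \<tau>_def norm_sgn)
  have "- 2 * Bil a b \<le> \<beta> * (inner_D D a a + inner_D D b b)"
    "- 2 * Bil (\<lambda>k. - a' k) b' \<le> \<beta> * (inner_D D (\<lambda>k. - a' k) (\<lambda>k. - a' k) + inner_D D b' b')"
    unfolding Bil_def z_def by (rule two_layer_curvature[OF lip r y l k lk]; assumption)+
  then have "2 * (real D * cmod \<zeta>) \<le> \<beta> * ((inner_D D a a + inner_D D a' a') + (inner_D D b b + inner_D D b' b'))"
    using Bil_diff neg by (simp add: inner_D_def algebra_simps)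
  also have "inner_D D a a + inner_D D a' a' = real D"
    using norm_wave[of D d] by (simp add: a_def a'_def inner_D_def cmod_def sum.distrib[symmetric] power2_eq_square)
  also have "inner_D D b b + inner_D D b' b' = real D * (cmod \<tau>)\<^sup>2"
  proof -
    have "Re (\<tau> * wave D d k) * Re (\<tau> * wave D d k) + Im (\<tau> * wave D d k) * Im (\<tau> * wave D d k)
       = (cmod \<tau>)\<^sup>2" for k
      using cmod_power2[of "\<tau> * wave D d k"]
      by (simp add: norm_mult power2_eq_square del: times_complex.sel)
    then show ?thesis
      by (simp add: b_def b'_def inner_D_def sum.distrib[symmetric] del: times_complex.sel)
  qed
  finally have main: "2 * (real D * cmod \<zeta>) \<le> \<beta> * (real D + real D * (cmod \<tau>)\<^sup>2)" .
  have "cmod \<zeta> \<le> \<beta>"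
  proof (cases "\<zeta> = 0")
    case True
    then have "0 \<le> \<beta> * real D" using main by (simp add: \<tau>_def)
    then show ?thesis using True d by (simp add: zero_le_mult_iff)
  next
    case False
    then have "real D * cmod \<zeta> \<le> real D * \<beta>" using main by (simp add: \<tau>_def norm_sgn mult.commute)
    then show ?thesis using d by simp
  qed
  then show ?thesis by (simp add: \<zeta>_def R_def z_def norm_mult prod_norm del: cnj_prod)
qed

text \<open>Direction \<open>e = u\<close>: with two layers the predictions are homogeneous of
  degree 2 and scale by \<open>(1 + s)\<^sup>2\<close>. The quadratic growth in the margins later
  forces the steps to vanish.\<close>

lemma radial_curvature:
  assumes lip: "local_lipschitz_grad D 2 N x y u r \<beta>" and r: "r > 0"
    and y: "\<And>n. n < N \<Longrightarrow> (y n)\<^sup>2 = 1"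
  shows "(\<Sum>n<N. exp (- (y n * inner_D D (x n) (P_conv D 2 u))) *
       (4 * (y n * inner_D D (x n) (P_conv D 2 u))\<^sup>2 - 2 * (y n * inner_D D (x n) (P_conv D 2 u))))
    \<le> \<beta> * (pnorm D 2 u)\<^sup>2"
proof -
  define M where "M n = inner_D D (x n) (P_conv D 2 u)" for n
  have 12: "{Suc 0..2} = {1, 2::nat}" by auto
  have "inner_D D (x n) (P_conv D 2 (\<lambda>l k. u l k + s * u l k)) = (1 + s)\<^sup>2 * M n" for n s
  proof -
    have "complex_of_real (inner_D D (x n) (P_conv D 2 (\<lambda>l k. u l k + s * u l k))) = of_real ((1 + s)\<^sup>2 * M n)"
      unfolding M_def of_real_mult
      by (simp add: inner_P_conv dft_add_scale 12 sum_distrib_left algebra_simps power2_eq_square)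
    then show ?thesis by (simp only: of_real_eq_iff)
  qed
  then have "(\<Sum>n<N. exp (- y n * ((1 + 0)\<^sup>2 * M n)) * ((2 * (1 + 0) * M n)\<^sup>2 - y n * (2 * M n)))
     \<le> \<beta> * (pnorm D 2 u)\<^sup>2"
    by (intro lipschitz_bounds_curvature[OF lip r, where e = u and Q = "\<lambda>n s. (1 + s)\<^sup>2 * M n"
        and Qd = "\<lambda>n s. 2 * (1 + s) * M n" and Qdd = "\<lambda>n. 2 * M n"])
      (auto intro!: derivative_eq_intros y)
  moreover have "(\<Sum>n<N. exp (- (y n * M n)) * (4 * (y n * M n)\<^sup>2 - 2 * (y n * M n)))
     = (\<Sum>n<N. exp (- y n * ((1 + 0)\<^sup>2 * M n)) * ((2 * (1 + 0) * M n)\<^sup>2 - y n * (2 * M n)))"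
    using y by (intro sum.cong) (simp_all add: power_mult_distrib)
  ultimately show ?thesis unfolding M_def by simp
qed

section \<open>Gradient descent trajectories\<close>

lemma parseval_norm: "(\<Sum>d<D. (cmod (dft D a d))\<^sup>2) = inner_D D a a"
  by (simp add: inner_dft cmod_power2 flip: power2_eq_square)

lemma pnorm_sq_dft: "(pnorm D L v)\<^sup>2 = (\<Sum>l\<in>{1..L}. \<Sum>d<D. (cmod (dft D (v l) d))\<^sup>2)"
  by (simp add: parseval_norm pnorm_def inner_D_def sum_nonneg flip: power2_eq_square)

text \<open>Both squares contain the same cross term \<open>2 * Re (a * b * cnj h)\<close>, which
  cancels.\<close>

lemma norm_sq_diff_step:
  fixes a b h :: complex
  shows "(cmod (a + h * cnj b))\<^sup>2 - (cmod (b + h * cnj a))\<^sup>2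
    = ((cmod a)\<^sup>2 - (cmod b)\<^sup>2) * (1 - (cmod h)\<^sup>2)"
  unfolding cmod_power2 by (simp add: algebra_simps power2_eq_square)

locale conv_gd =
  fixes D L N :: nat and x :: "nat \<Rightarrow> nat \<Rightarrow> real" and y :: "nat \<Rightarrow> real"
    and u :: "nat \<Rightarrow> nat \<Rightarrow> nat \<Rightarrow> real" and \<eta> :: "nat \<Rightarrow> real"
  assumes L2: "L \<ge> 2" and D1: "D \<ge> 1" and N1: "N \<ge> 1"
    and y_sq: "\<And>n. n < N \<Longrightarrow> (y n)\<^sup>2 = 1"
    and step: "\<And>t. step_size_ok D L N x y (u t) (\<eta> t)"
    and update: "\<And>t l k. l \<in> {1..L} \<Longrightarrow> k < D \<Longrightarrow>
      u (Suc t) l k = u t l k - \<eta> t * grad_params D L N x y (u t) l k"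
    and loss: "(\<lambda>t. conv_loss D L N x y (u t)) \<longlonglongrightarrow> 0"
begin

definition U :: "nat \<Rightarrow> nat \<Rightarrow> nat \<Rightarrow> complex" where
  "U t l d = dft D (u t l) d"

definition w :: "nat \<Rightarrow> nat \<Rightarrow> real" where
  "w t = P_conv D L (u t)"

definition M :: "nat \<Rightarrow> nat \<Rightarrow> real" where
  "M t n = y n * inner_D D (x n) (w t)"

definition z :: "nat \<Rightarrow> nat \<Rightarrow> real" where
  "z t = neg_grad D N x y (w t)"

definition Z :: "nat \<Rightarrow> nat \<Rightarrow> complex" where
  "Z t d = dft D (z t) d"

lemma L1: "L \<ge> 1" using L2 by simp

lemma eta_pos: "\<eta> t > 0"
  using step[of t] by (simp add: step_size_ok_def)

lemma dft_w: "d < D \<Longrightarrow> dft D (w t) d = (\<Prod>j\<in>{1..L}. U t j d)"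
  unfolding w_def U_def by (rule dft_P_conv[OF L1])

lemma M_eq: "M t n = y n * Re (\<Sum>d<D. dft D (x n) d * cnj (\<Prod>j\<in>{1..L}. U t j d))"
  unfolding M_def w_def U_def inner_P_conv[OF L1, symmetric] by simp

lemma Z_eq: "Z t d = (\<Sum>n<N. of_real (exp (- M t n) * y n) * dft D (x n) d)"
  by (simp add: Z_def z_def dft_neg_grad M_def)

lemma loss_eq: "conv_loss D L N x y (u t) = (\<Sum>n<N. exp (- M t n))"
  by (simp add: conv_loss_def exp_loss_def M_def w_def)

lemma U_Suc:
  assumes "l \<in> {1..L}" "d < D"
  shows "U (Suc t) l d = U t l d + of_real (\<eta> t) * Z t d * cnj (\<Prod>j\<in>{1..L} - {l}. U t j d)"
proof -
  have "U (Suc t) l d = dft D (\<lambda>k. u t l k + (- \<eta> t) * grad_params D L N x y (u t) l k) d"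
    unfolding U_def using assms by (intro dft_cong) (simp add: update)
  also have "\<dots> = U t l d + of_real (- \<eta> t) * dft D (grad_params D L N x y (u t) l) d"
    unfolding U_def by (rule dft_add_scale)
  finally show ?thesis
    using dft_grad_params[OF assms, of N x y "u t"] by (simp add: U_def Z_def z_def w_def)
qed

lemma exp_margin_to_0:
  assumes "n < N"
  shows "(\<lambda>t. exp (- M t n)) \<longlonglongrightarrow> 0"
proof (rule tendsto_sandwich[OF _ _ tendsto_const loss])
  show "\<forall>\<^sub>F t in sequentially. exp (- M t n) \<le> conv_loss D L N x y (u t)"
    unfolding loss_eq using assms by (intro always_eventually allI member_le_sum) auto
qed simp

lemma margin_at_top:
  assumes "n < N"
  shows "filterlim (\<lambda>t. M t n) at_top sequentially"
proof -
  have "filterlim (\<lambda>t. exp (- M t n)) (at_right 0) sequentially"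
    using exp_margin_to_0[OF assms] by (simp add: filterlim_at)
  then have "filterlim (\<lambda>t. ln (exp (- M t n))) at_bot sequentially"
    by (rule filterlim_compose[OF ln_at_0])
  then show ?thesis by (simp add: filterlim_uminus_at_top)
qed

text \<open>At a critical point the iteration stalls, the margins stay constant and the loss cannot
  tend to 0. This gives the ball in the step-size condition a positive radius.\<close>

lemma gradient_nonzero: "pnorm D L (grad_params D L N x y (u t)) > 0"
proof (rule ccontr)
  assume "\<not> pnorm D L (grad_params D L N x y (u t)) > 0"
  then have "pnorm D L (grad_params D L N x y (u t)) = 0"
    using pnorm_nonneg[of D L "grad_params D L N x y (u t)"] by linarith
  then have "grad_params D L N x y (u t) l k = 0" if "l \<in> {1..L}" "k < D" for l k
    using that unfolding pnorm_L2_set by (subst (asm) L2_set_eq_0_iff) auto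
  then have grad0: "dft D (grad_params D L N x y (u t) l) d = 0" if "l \<in> {1..L}" for l d
    using that by (simp add: dft_def)
  have still: "Z t d * cnj (\<Prod>j\<in>{1..L} - {l}. U t j d) = 0" if "l \<in> {1..L}" "d < D" for l d
    using dft_grad_params[OF that, of N x y "u t"] grad0[OF that(1)]
    by (simp add: U_def Z_def z_def w_def)
  \<comment> \<open>Constancy is stated for the transforms because the update rule governs only the
    entries with \<open>l \<in> {1..L}\<close> and \<open>k < D\<close>.\<close>
  have const: "\<forall>l\<in>{1..L}. \<forall>d<D. U (t + s) l d = U t l d" for s
  proof (induction s)
    case (Suc s)
    then have prods: "(\<Prod>j\<in>A. U (t + s) j d) = (\<Prod>j\<in>A. U t j d)" if "A \<subseteq> {1..L}" "d < D" for A d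
      using that by (intro prod.cong) auto
    have "M (t + s) n = M t n" for n
      unfolding M_eq using prods[of "{1..L}"] by (metis (no_types, lifting) lessThan_iff order_refl sum.cong)
    then have "Z (t + s) d = Z t d" for d
      unfolding Z_eq by simp
    then show ?case
      using Suc still prods by (auto simp: U_Suc mult.assoc simp del: cnj_prod)
  qed simp
  have M_const: "M (t + s) n = M t n" for s n
  proof -
    have "(\<Sum>d<D. dft D (x n) d * cnj (\<Prod>j\<in>{1..L}. U (t + s) j d))
       = (\<Sum>d<D. dft D (x n) d * cnj (\<Prod>j\<in>{1..L}. U t j d))"
      using const[of s] by (intro sum.cong arg_cong2[of _ _ _ _ "(*)"] arg_cong[of _ _ cnj] prod.cong) auto
    then show ?thesis by (simp only: M_eq)
  qed
  have "(\<lambda>s. M (s + t) 0) = (\<lambda>s. M t 0)"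
    using M_const by (simp add: add.commute)
  moreover have "filterlim (\<lambda>s. M (s + t) 0) at_top sequentially"
    by (rule filterlim_compose[OF margin_at_top filterlim_add_const_nat_at_top]) (use N1 in simp)
  ultimately have "filterlim (\<lambda>s. M t 0) at_top (sequentially :: nat filter)" by simp
  then have "\<forall>\<^sub>F s in (sequentially :: nat filter). M t 0 > M t 0"
    unfolding filterlim_at_top_dense by blast
  then show False by simp
qed

lemma local_lipschitz:
  obtains r \<beta> where "r > 0" "\<beta> \<ge> 0" "\<eta> t * \<beta> < 1" "local_lipschitz_grad D L N x y (u t) r \<beta>"
proof -
  obtain \<beta> where "\<beta> \<ge> 0" "\<eta> t * \<beta> < 1"
    "local_lipschitz_grad D L N x y (u t) (\<eta> t * pnorm D L (grad_params D L N x y (u t))) \<beta>"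
    using step[of t] unfolding step_size_ok_def local_lipschitz_grad_def by blast
  moreover have "\<eta> t * pnorm D L (grad_params D L N x y (u t)) > 0"
    using eta_pos gradient_nonzero by simp
  ultimately show thesis using that by blast
qed

text \<open>Combines \<open>\<eta> t * \<beta> < 1\<close> with \<open>mode_curvature\<close>; the
  bounded quantity is the one squared in \<open>balance_step\<close>.\<close>

lemma mode_step_less_1:
  assumes "l \<in> {1..L}" "k \<in> {1..L}" "l \<noteq> k" "d < D"
  shows "\<eta> t * (cmod (Z t d) * (\<Prod>j\<in>{1..L} - {l, k}. cmod (U t j d))) < 1"
proof -
  obtain r \<beta> where *: "r > 0" "\<beta> \<ge> 0" "\<eta> t * \<beta> < 1" "local_lipschitz_grad D L N x y (u t) r \<beta>"
    by (rule local_lipschitz)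
  have "cmod (Z t d) * (\<Prod>j\<in>{1..L} - {l, k}. cmod (U t j d)) \<le> \<beta>"
    unfolding Z_def z_def w_def U_def by (rule mode_curvature[OF *(4,1) y_sq assms])
  then have "\<eta> t * (cmod (Z t d) * (\<Prod>j\<in>{1..L} - {l, k}. cmod (U t j d))) \<le> \<eta> t * \<beta>"
    using eta_pos[of t] by (intro mult_left_mono) auto
  then show ?thesis using *(3) by linarith
qed

text \<open>With the remaining layers absorbed into a common factor \<open>h\<close>, layers
  \<open>l\<close> and \<open>k\<close> perform the two-variable step of
  \<open>norm_sq_diff_step\<close>.\<close>

lemma balance_step:
  assumes "l \<in> {1..L}" "k \<in> {1..L}" "l \<noteq> k" "d < D"
  shows "(cmod (U (Suc t) l d))\<^sup>2 - (cmod (U (Suc t) k d))\<^sup>2 = ((cmod (U t l d))\<^sup>2 - (cmod (U t k d))\<^sup>2)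
     * (1 - (\<eta> t * (cmod (Z t d) * (\<Prod>j\<in>{1..L} - {l, k}. cmod (U t j d))))\<^sup>2)"
proof -
  define h where "h = of_real (\<eta> t) * Z t d * cnj (\<Prod>j\<in>{1..L} - {l, k}. U t j d)"
  have "{1..L} - {l} - {k} = {1..L} - {l, k}" "{1..L} - {k} - {l} = {1..L} - {l, k}" by auto
  then have "(\<Prod>j\<in>{1..L} - {l}. U t j d) = U t k d * (\<Prod>j\<in>{1..L} - {l, k}. U t j d)"
    "(\<Prod>j\<in>{1..L} - {k}. U t j d) = U t l d * (\<Prod>j\<in>{1..L} - {l, k}. U t j d)"
    using assms prod.remove[of "{1..L} - {l}" k "\<lambda>j. U t j d"] prod.remove[of "{1..L} - {k}" l "\<lambda>j. U t j d"]
    by auto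
  then have "U (Suc t) l d = U t l d + h * cnj (U t k d)" "U (Suc t) k d = U t k d + h * cnj (U t l d)"
    using assms by (simp_all add: U_Suc h_def)
  moreover have "cmod h = \<eta> t * (cmod (Z t d) * (\<Prod>j\<in>{1..L} - {l, k}. cmod (U t j d)))"
    using eta_pos[of t] by (simp add: h_def norm_mult prod_norm abs_of_pos del: cnj_prod)
  ultimately show ?thesis by (simp add: norm_sq_diff_step)
qed

lemma balance_bounded:
  assumes "l \<in> {1..L}" "k \<in> {1..L}" "d < D"
  shows "\<bar>(cmod (U t l d))\<^sup>2 - (cmod (U t k d))\<^sup>2\<bar> \<le> \<bar>(cmod (U 0 l d))\<^sup>2 - (cmod (U 0 k d))\<^sup>2\<bar>"
proof (cases "l = k")
  case False
  show ?thesis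
  proof (induction t)
    case (Suc t)
    define a where "a = \<eta> t * (cmod (Z t d) * (\<Prod>j\<in>{1..L} - {l, k}. cmod (U t j d)))"
    have "0 \<le> a" "a < 1"
      using mode_step_less_1[OF assms(1,2) False assms(3)] eta_pos[of t]
      by (auto simp: a_def intro!: mult_nonneg_nonneg prod_nonneg)
    then have "0 \<le> 1 - a\<^sup>2" "1 - a\<^sup>2 \<le> 1" by (simp_all add: power_le_one)
    then have "\<bar>(cmod (U (Suc t) l d))\<^sup>2 - (cmod (U (Suc t) k d))\<^sup>2\<bar> \<le> \<bar>(cmod (U t l d))\<^sup>2 - (cmod (U t k d))\<^sup>2\<bar>"
      unfolding balance_step[OF assms(1,2) False assms(3)] a_def[symmetric] abs_mult
      by (simp add: mult_left_le)
    with Suc show ?case by linarith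
  qed simp
qed simp

lemma U_le_pnorm:
  assumes "l \<in> {1..L}" "d < D"
  shows "cmod (U t l d) \<le> pnorm D L (u t)"
proof -
  have "(cmod (U t l d))\<^sup>2 \<le> (\<Sum>d<D. (cmod (U t l d))\<^sup>2)"
    using assms by (intro member_le_sum) auto
  also have "\<dots> \<le> (\<Sum>l\<in>{1..L}. \<Sum>d<D. (cmod (U t l d))\<^sup>2)"
    using assms by (intro member_le_sum[of l _ "\<lambda>l. \<Sum>d<D. (cmod (U t l d))\<^sup>2"]) (auto intro: sum_nonneg)
  also have "\<dots> = (pnorm D L (u t))\<^sup>2" by (simp add: pnorm_sq_dft U_def)
  finally show ?thesis by (rule power2_le_imp_le) simp
qed

text \<open>A margin is at most a constant times the \<open>L\<close>-th power of the parameter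
  norm, and it diverges.\<close>

lemma pnorm_at_top: "filterlim (\<lambda>t. pnorm D L (u t)) at_top sequentially"
proof -
  define C where "C = \<bar>y 0\<bar> * (\<Sum>d<D. cmod (dft D (x 0) d))"
  have C0: "0 \<le> C" by (simp add: C_def sum_nonneg)
  have bound: "M t 0 \<le> C * pnorm D L (u t) ^ L" for t
  proof -
    have "cmod (\<Sum>d<D. dft D (x 0) d * cnj (\<Prod>j\<in>{1..L}. U t j d))
       \<le> (\<Sum>d<D. cmod (dft D (x 0) d) * pnorm D L (u t) ^ L)"
    proof (rule sum_norm_le)
      fix d assume d: "d \<in> {..<D}"
      have "(\<Prod>j\<in>{1..L}. cmod (U t j d)) \<le> (\<Prod>j\<in>{1..L}. pnorm D L (u t))"
        using d by (intro prod_mono) (auto intro: U_le_pnorm)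
      then show "cmod (dft D (x 0) d * cnj (\<Prod>j\<in>{1..L}. U t j d)) \<le> cmod (dft D (x 0) d) * pnorm D L (u t) ^ L"
        by (simp add: norm_mult prod_norm mult_left_mono del: cnj_prod)
    qed
    then have "\<bar>Re (\<Sum>d<D. dft D (x 0) d * cnj (\<Prod>j\<in>{1..L}. U t j d))\<bar>
       \<le> (\<Sum>d<D. cmod (dft D (x 0) d)) * pnorm D L (u t) ^ L"
      unfolding sum_distrib_right using abs_Re_le_cmod order_trans by blast
    then have "\<bar>M t 0\<bar> \<le> C * pnorm D L (u t) ^ L"
      unfolding M_eq C_def abs_mult by (simp add: mult.assoc mult_left_mono)
    then show ?thesis by linarith
  qed
  show ?thesis
    unfolding filterlim_at_top
  proof
    fix B :: real
    define B' where "B' = max B 0"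
    have "\<forall>\<^sub>F t in sequentially. M t 0 > C * B' ^ L"
      using margin_at_top[of 0] N1 unfolding filterlim_at_top_dense by auto
    then show "\<forall>\<^sub>F t in sequentially. B \<le> pnorm D L (u t)"
    proof eventually_elim
      case (elim t)
      then have "C * B' ^ L < C * pnorm D L (u t) ^ L" using bound[of t] by linarith
      then have "B' ^ L < pnorm D L (u t) ^ L" using C0 by (simp add: mult_less_cancel_left)
      then have "B' < pnorm D L (u t)" by (rule power_less_imp_less_base) simp
      then show ?case by (simp add: B'_def)
    qed
  qed
qed

end

section \<open>Limit directions\<close>

text \<open>Once \<open>c\<close> is within \<open>\<epsilon> / 2\<close> of its limit, the error of
  \<open>V\<close> grows by at most \<open>\<epsilon> / 2\<close> per unit of accumulated weight;
  the diverging weight drowns the earlier error.\<close>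

lemma stolz_cesaro_weighted:
  fixes V c :: "nat \<Rightarrow> 'a::real_normed_vector" and b :: "nat \<Rightarrow> real"
  assumes b: "\<And>t. b t \<ge> 0"
    and S: "filterlim (\<lambda>t. \<Sum>s<t. b s) at_top sequentially"
    and V: "\<And>t. V (Suc t) - V t = b t *\<^sub>R c t"
    and c: "c \<longlonglongrightarrow> C"
  shows "(\<lambda>t. V t /\<^sub>R (\<Sum>s<t. b s)) \<longlonglongrightarrow> C"
proof (rule metric_LIMSEQ_I)
  fix \<epsilon> :: real assume \<epsilon>: "\<epsilon> > 0"
  define S where "S t = (\<Sum>s<t. b s)" for t
  define e where "e t = norm (V t - S t *\<^sub>R C)" for t
  obtain T where T: "\<And>t. t \<ge> T \<Longrightarrow> norm (c t - C) < \<epsilon> / 2"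
    using metric_LIMSEQ_D[OF c, of "\<epsilon> / 2"] \<epsilon> by (auto simp: dist_norm)
  have eT: "e t \<le> e T + \<epsilon> / 2 * (S t - S T)" if "t \<ge> T" for t
    using that
  proof (induction t rule: dec_induct)
    case (step t)
    have "V (Suc t) - S (Suc t) *\<^sub>R C = (V t - S t *\<^sub>R C) + b t *\<^sub>R (c t - C)"
      using V[of t] by (simp add: S_def algebra_simps)
    then have "e (Suc t) \<le> e t + b t * norm (c t - C)"
      unfolding e_def using norm_triangle_ineq[of "V t - S t *\<^sub>R C" "b t *\<^sub>R (c t - C)"] b[of t] by simp
    also have "\<dots> \<le> e t + b t * (\<epsilon> / 2)"
      using T[of t] step b[of t] by (intro add_left_mono mult_left_mono) auto
    finally show ?case using step by (simp add: S_def algebra_simps)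
  qed simp
  have ST: "S T \<ge> 0" using b by (simp add: S_def sum_nonneg)
  have "\<forall>\<^sub>F t in sequentially. S t > 2 * e T / \<epsilon> \<and> S t > 0 \<and> t \<ge> T"
    using S unfolding S_def[symmetric] filterlim_at_top_dense
    by (intro eventually_conj eventually_ge_at_top) auto
  then have "\<forall>\<^sub>F t in sequentially. dist (V t /\<^sub>R S t) C < \<epsilon>"
  proof eventually_elim
    case (elim t)
    have "e t \<le> e T + \<epsilon> / 2 * S t"
      using eT[of t] elim ST \<epsilon> mult_left_mono[of "S t - S T" "S t" "\<epsilon> / 2"] by linarith
    also have "\<dots> < \<epsilon> * S t"
      using elim \<epsilon> by (simp add: field_simps)
    finally have "e t / S t < \<epsilon>" using elim by (simp add: pos_divide_less_eq)
    moreover have "V t /\<^sub>R S t - C = (V t - S t *\<^sub>R C) /\<^sub>R S t"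
      using elim by (simp add: algebra_simps)
    ultimately show ?case
      using elim by (simp add: dist_norm e_def divide_inverse mult.commute)
  qed
  then show "\<exists>no. \<forall>t\<ge>no. dist (V t /\<^sub>R (\<Sum>s<t. b s)) C < \<epsilon>"
    by (simp add: S_def eventually_sequentially)
qed

text \<open>For the dual coefficients: when data vectors are linearly dependent, convergence of the
  residual direction does not make its coefficients converge, so a subsequence is taken.\<close>

lemma bounded_finite_family_convergent_subseq:
  fixes a :: "nat \<Rightarrow> nat \<Rightarrow> real"
  assumes "\<And>n t. n < N \<Longrightarrow> \<bar>a t n\<bar> \<le> B"
  shows "\<exists>s \<alpha>. strict_mono (s :: nat \<Rightarrow> nat) \<and> (\<forall>n<N. (\<lambda>t. a (s t) n) \<longlonglongrightarrow> \<alpha> n)"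
  using assms
proof (induction N)
  case 0
  then show ?case using strict_mono_id by auto
next
  case (Suc N)
  then obtain s \<alpha> where s: "strict_mono s" "\<forall>n<N. (\<lambda>t. a (s t) n) \<longlonglongrightarrow> \<alpha> n"
    by (metis less_Suc_eq)
  have "bounded (range (\<lambda>t. a (s t) N))"
    using Suc.prems[of N] by (auto simp: bounded_iff intro!: exI[of _ B])
  then obtain l s' where s': "strict_mono s'" "((\<lambda>t. a (s t) N) \<circ> s') \<longlonglongrightarrow> l"
    using bounded_imp_convergent_subsequence by blast
  have "(\<lambda>t. a ((s \<circ> s') t) n) \<longlonglongrightarrow> (\<alpha>(N := l)) n" if "n < Suc N" for n
  proof (cases "n = N")
    case True
    then show ?thesis using s'(2) by (simp add: o_def)
  next
    case False
    then have "(\<lambda>t. a (s t) n) \<longlonglongrightarrow> \<alpha> n" using s(2) that by simp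
    from LIMSEQ_subseq_LIMSEQ[OF this s'(1)] show ?thesis using False by (simp add: o_def)
  qed
  moreover have "strict_mono (s \<circ> s')" using s(1) s'(1) by (rule strict_mono_o)
  ultimately show ?case by blast
qed

lemma dft_tendsto:
  assumes "\<And>k. k < D \<Longrightarrow> (\<lambda>t. a t k) \<longlonglongrightarrow> b k"
  shows "(\<lambda>t. dft D (a t) d) \<longlonglongrightarrow> dft D b d"
  unfolding dft_def by (intro tendsto_intros) (simp add: assms)

lemma vnorm_sq: "(vnorm D a)\<^sup>2 = inner_D D a a"
  by (simp add: vnorm_def inner_D_def sum_nonneg flip: power2_eq_square)

lemma vnorm_dft: "vnorm D a = sqrt (\<Sum>d<D. (cmod (dft D a d))\<^sup>2)"
  by (simp add: parseval_norm vnorm_def inner_D_def flip: power2_eq_square)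

lemma vnorm_nonneg [simp]: "0 \<le> vnorm D a"
  by (simp add: vnorm_def sum_nonneg)

lemma vnorm_L2_set: "vnorm D a = L2_set a {..<D}"
  by (simp add: vnorm_def L2_set_def)

lemma vnorm_minus: "vnorm D (\<lambda>k. - a k) = vnorm D a"
  by (simp add: vnorm_def)

lemma vnorm_cong: "(\<And>k. k < D \<Longrightarrow> a k = b k) \<Longrightarrow> vnorm D a = vnorm D b"
  by (simp add: vnorm_def)

lemma inner_le_vnorm: "inner_D D a b \<le> vnorm D a * vnorm D b"
proof -
  have "inner_D D a b \<le> (\<Sum>k<D. \<bar>a k\<bar> * \<bar>b k\<bar>)"
    unfolding inner_D_def by (intro sum_mono) (metis abs_ge_self abs_mult)
  also have "\<dots> \<le> vnorm D a * vnorm D b"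
    unfolding vnorm_L2_set by (rule L2_set_mult_ineq)
  finally show ?thesis .
qed

lemma dft_le_vnorm:
  assumes "d < D"
  shows "cmod (dft D a d) \<le> vnorm D a"
proof -
  have "(cmod (dft D a d))\<^sup>2 \<le> (\<Sum>d<D. (cmod (dft D a d))\<^sup>2)"
    using assms by (intro member_le_sum) auto
  then show ?thesis unfolding vnorm_dft by (rule real_le_rsqrt)
qed

locale conv_gd_limit = conv_gd +
  fixes ubar :: "nat \<Rightarrow> nat \<Rightarrow> real" and wbar g :: "nat \<Rightarrow> real"
  assumes ubar: "\<And>l k. l \<in> {1..L} \<Longrightarrow> k < D \<Longrightarrow> (\<lambda>t. u t l k / pnorm D L (u t)) \<longlonglongrightarrow> ubar l k"
    and wbar: "\<And>k. k < D \<Longrightarrow> (\<lambda>t. P_conv D L (u t) k / vnorm D (P_conv D L (u t))) \<longlonglongrightarrow> wbar k"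
    and wbar_margin: "\<And>n. n < N \<Longrightarrow> y n * inner_D D (x n) wbar > 0"
    and grad_dir: "\<And>k. k < D \<Longrightarrow> (\<lambda>t. grad_w D N x y (P_conv D L (u t)) k
         / vnorm D (grad_w D N x y (P_conv D L (u t)))) \<longlonglongrightarrow> g k"
begin

section \<open>Normalized parameters, predictor and margins in the limit\<close>

definition r :: "nat \<Rightarrow> real" where "r t = pnorm D L (u t)"

definition Ub :: "nat \<Rightarrow> nat \<Rightarrow> complex" where "Ub l d = dft D (ubar l) d"

definition \<Omega> :: "nat \<Rightarrow> complex" where "\<Omega> d = (\<Prod>j\<in>{1..L}. Ub j d)"

text \<open>Layer 1 stands for all layers: by \<open>norm_Ub\<close> their limits have equal modulus
  at each frequency.\<close>

definition \<rho> :: "nat \<Rightarrow> real" where "\<rho> d = cmod (Ub 1 d)"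

definition zb :: "nat \<Rightarrow> real" where "zb k = - g k"

definition Zb :: "nat \<Rightarrow> complex" where "Zb d = dft D zb d"

text \<open>The limit of \<open>vnorm D (w t) / r t ^ L\<close>; it converts between normalizing by
  the parameters and by the predictor.\<close>

definition K :: real where "K = sqrt (\<Sum>d<D. (cmod (\<Omega> d))\<^sup>2)"

definition nz :: "nat \<Rightarrow> real" where "nz t = vnorm D (z t)"

definition \<mu> :: "nat \<Rightarrow> real" where "\<mu> n = y n * inner_D D (x n) wbar"

definition \<mu>0 :: real where "\<mu>0 = Min (\<mu> ` {..<N})"

lemma \<mu>0_le: "n < N \<Longrightarrow> \<mu>0 \<le> \<mu> n"
  unfolding \<mu>0_def by (intro Min_le) auto

lemma index_nonempty: "{..<N} \<noteq> {}"
  using N1 by (metis lessThan_iff empty_iff less_eq_Suc_le One_nat_def)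

lemma \<mu>0_attained: "\<exists>n<N. \<mu> n = \<mu>0"
proof -
  have "\<mu>0 \<in> \<mu> ` {..<N}"
    unfolding \<mu>0_def using index_nonempty by (intro Min_in) auto
  then show ?thesis by auto
qed

lemma \<mu>0_pos: "\<mu>0 > 0"
  using \<mu>0_attained wbar_margin unfolding \<mu>_def by metis

text \<open>If the parameters vanished, every gradient block would contain another, zero layer as a
  factor because \<open>L \<ge> 2\<close>, contradicting \<open>gradient_nonzero\<close>.\<close>

lemma r_pos: "r t > 0"
proof (rule ccontr)
  assume "\<not> r t > 0"
  then have "r t = 0"
    using pnorm_nonneg[of D L "u t"] unfolding r_def by linarith
  then have U0: "U t j d = 0" if "j \<in> {1..L}" "d < D" for j d
    using U_le_pnorm[OF that, of t] by (simp add: r_def)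
  have "dft D (grad_params D L N x y (u t) l) d = 0" if "l \<in> {1..L}" "d < D" for l d
  proof -
    define j where "j = (if l = 1 then 2 else (1::nat))"
    have "j \<in> {1..L} - {l}"
      using L2 by (auto simp: j_def)
    then have "(\<Prod>j\<in>{1..L} - {l}. U t j d) = 0"
      using U0[of j d] that by (intro prod_zero bexI[of _ j]) auto
    then show ?thesis using dft_grad_params[OF that, of N x y "u t"] by (simp add: U_def)
  qed
  then have "(pnorm D L (grad_params D L N x y (u t)))\<^sup>2 = 0"
    unfolding pnorm_sq_dft by simp
  then show False using gradient_nonzero[of t] by simp
qed

lemma U_lim:
  assumes "l \<in> {1..L}"
  shows "(\<lambda>t. U t l d / of_real (r t)) \<longlonglongrightarrow> Ub l d"
proof -
  have "(\<lambda>t. dft D (\<lambda>k. u t l k / r t) d) \<longlonglongrightarrow> Ub l d"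
    unfolding Ub_def r_def using assms ubar by (intro dft_tendsto) auto
  moreover have "dft D (\<lambda>k. u t l k / r t) d = U t l d / of_real (r t)" for t
    using dft_scale[of D "1 / r t" "u t l" d] by (simp add: U_def)
  ultimately show ?thesis by simp
qed

text \<open>The gap of squared moduli stays bounded and is divided by \<open>(r t)\<^sup>2\<close>,
  which diverges.\<close>

lemma norm_Ub:
  assumes l: "l \<in> {1..L}" and d: "d < D"
  shows "cmod (Ub l d) = \<rho> d"
proof -
  have 1: "1 \<in> {1..L}" using L1 by simp
  have "(\<lambda>t. ((cmod (U t l d))\<^sup>2 - (cmod (U t 1 d))\<^sup>2) / (r t)\<^sup>2) \<longlonglongrightarrow> 0"
  proof (rule Lim_null_comparison)
    show "\<forall>\<^sub>F t in sequentially. norm (((cmod (U t l d))\<^sup>2 - (cmod (U t 1 d))\<^sup>2) / (r t)\<^sup>2)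
       \<le> \<bar>(cmod (U 0 l d))\<^sup>2 - (cmod (U 0 1 d))\<^sup>2\<bar> / (r t)\<^sup>2"
      using balance_bounded[OF l 1 d]
      by (intro always_eventually allI) (simp add: abs_divide divide_right_mono)
    have "filterlim (\<lambda>t. (r t)\<^sup>2) at_top sequentially"
      unfolding r_def by (rule filterlim_pow_at_top[OF _ pnorm_at_top]) simp
    then show "(\<lambda>t. \<bar>(cmod (U 0 l d))\<^sup>2 - (cmod (U 0 1 d))\<^sup>2\<bar> / (r t)\<^sup>2) \<longlonglongrightarrow> 0"
      by (intro tendsto_divide_0[OF tendsto_const] filterlim_at_top_imp_at_infinity)
  qed
  moreover have "(\<lambda>t. (cmod (U t l d / of_real (r t)))\<^sup>2 - (cmod (U t 1 d / of_real (r t)))\<^sup>2)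
     \<longlonglongrightarrow> (cmod (Ub l d))\<^sup>2 - (cmod (Ub 1 d))\<^sup>2"
    by (intro tendsto_intros U_lim l 1)
  moreover have "(cmod (U t l d / of_real (r t)))\<^sup>2 - (cmod (U t 1 d / of_real (r t)))\<^sup>2
     = ((cmod (U t l d))\<^sup>2 - (cmod (U t 1 d))\<^sup>2) / (r t)\<^sup>2" for t
    by (simp add: norm_divide power_divide diff_divide_distrib)
  ultimately have "(cmod (Ub l d))\<^sup>2 - (cmod (Ub 1 d))\<^sup>2 = 0"
    using LIMSEQ_unique by (simp only:)
  then show ?thesis by (simp add: \<rho>_def)
qed

lemma norm_\<Omega>: "d < D \<Longrightarrow> cmod (\<Omega> d) = \<rho> d ^ L"
  by (simp add: \<Omega>_def norm_Ub flip: prod_norm)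

text \<open>The normalized spectra have total square 1 at every time, and finite sums pass to the
  limit.\<close>

lemma exists_active: "\<exists>d<D. \<rho> d > 0"
proof (rule ccontr)
  assume "\<not> (\<exists>d<D. \<rho> d > 0)"
  then have "\<rho> d \<le> 0" if "d < D" for d
    using that not_less by auto
  then have 0: "Ub l d = 0" if "l \<in> {1..L}" "d < D" for l d
    using norm_Ub[OF that] that(2) by (metis norm_le_zero_iff)
  have "(\<lambda>t. \<Sum>l\<in>{1..L}. \<Sum>d<D. (cmod (U t l d / of_real (r t)))\<^sup>2)
     \<longlonglongrightarrow> (\<Sum>l\<in>{1..L}. \<Sum>d<D. (cmod (Ub l d))\<^sup>2)"
    by (intro tendsto_intros U_lim)
  moreover have "(\<Sum>l\<in>{1..L}. \<Sum>d<D. (cmod (U t l d / of_real (r t)))\<^sup>2) = 1" for t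
  proof -
    have "(\<Sum>l\<in>{1..L}. \<Sum>d<D. (cmod (U t l d / of_real (r t)))\<^sup>2) = (r t)\<^sup>2 / (r t)\<^sup>2"
      by (simp add: norm_divide power_divide pnorm_sq_dft r_def U_def flip: sum_divide_distrib)
    then show ?thesis using r_pos[of t] by simp
  qed
  ultimately show False using 0 by (simp add: LIMSEQ_const_iff)
qed

lemma K_pos: "K > 0"
proof -
  obtain d where d: "d < D" "\<rho> d > 0" using exists_active by blast
  then have "0 < (cmod (\<Omega> d))\<^sup>2" using norm_\<Omega> by simp
  also have "\<dots> \<le> (\<Sum>d<D. (cmod (\<Omega> d))\<^sup>2)" using d by (intro member_le_sum) auto
  finally show ?thesis by (simp add: K_def)
qed

lemma W_lim:
  assumes "d < D"
  shows "(\<lambda>t. dft D (w t) d / of_real (r t ^ L)) \<longlonglongrightarrow> \<Omega> d"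
proof -
  have "(\<lambda>t. \<Prod>j\<in>{1..L}. U t j d / of_real (r t)) \<longlonglongrightarrow> \<Omega> d"
    unfolding \<Omega>_def by (intro tendsto_prod U_lim)
  then show ?thesis using assms by (simp add: dft_w prod_dividef)
qed

lemma vnorm_w_lim: "(\<lambda>t. vnorm D (w t) / r t ^ L) \<longlonglongrightarrow> K"
proof -
  have "(\<lambda>t. sqrt (\<Sum>d<D. (cmod (dft D (w t) d / of_real (r t ^ L)))\<^sup>2)) \<longlonglongrightarrow> K"
    unfolding K_def by (intro tendsto_intros W_lim) simp
  moreover have "sqrt (\<Sum>d<D. (cmod (dft D (w t) d / of_real (r t ^ L)))\<^sup>2) = vnorm D (w t) / r t ^ L" for t
    using r_pos[of t] unfolding vnorm_dft
    by (simp add: norm_divide norm_power power_divide real_sqrt_divide flip: sum_divide_distrib)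
  ultimately show ?thesis by simp
qed

lemma dft_wbar:
  assumes "d < D"
  shows "dft D wbar d = \<Omega> d / of_real K"
proof -
  have "(\<lambda>t. dft D (\<lambda>k. w t k / vnorm D (w t)) d) \<longlonglongrightarrow> dft D wbar d"
    unfolding w_def by (intro dft_tendsto wbar)
  moreover have "dft D (\<lambda>k. w t k / vnorm D (w t)) d
     = (dft D (w t) d / of_real (r t ^ L)) / of_real (vnorm D (w t) / r t ^ L)" for t
    using r_pos[of t] dft_scale[of D "1 / vnorm D (w t)" "w t" d] by simp
  moreover have "(\<lambda>t. (dft D (w t) d / of_real (r t ^ L)) / of_real (vnorm D (w t) / r t ^ L)) \<longlonglongrightarrow> \<Omega> d / of_real K"
    using K_pos by (intro tendsto_divide tendsto_of_real W_lim vnorm_w_lim assms) auto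
  ultimately show ?thesis using LIMSEQ_unique by (simp only:)
qed

lemma M_lim:
  shows "(\<lambda>t. M t n / vnorm D (w t)) \<longlonglongrightarrow> \<mu> n"
proof -
  have "(\<lambda>t. y n * (\<Sum>k<D. x n k * (w t k / vnorm D (w t)))) \<longlonglongrightarrow> y n * (\<Sum>k<D. x n k * wbar k)"
    unfolding w_def by (intro tendsto_intros wbar) simp
  then show ?thesis by (simp add: M_def \<mu>_def inner_D_def flip: sum_divide_distrib)
qed

lemma vnorm_w_at_top: "filterlim (\<lambda>t. vnorm D (w t)) at_top sequentially"
proof -
  have "filterlim (\<lambda>t. r t ^ L) at_top sequentially"
    unfolding r_def using L1 by (intro filterlim_pow_at_top[OF _ pnorm_at_top]) simp
  then have "filterlim (\<lambda>t. (vnorm D (w t) / r t ^ L) * r t ^ L) at_top sequentially"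
    by (rule filterlim_tendsto_pos_mult_at_top[OF vnorm_w_lim K_pos])
  moreover have "(vnorm D (w t) / r t ^ L) * r t ^ L = vnorm D (w t)" for t
    using r_pos[of t] by simp
  ultimately show ?thesis by simp
qed

section \<open>The residual direction and the dual variables\<close>

lemma inner_z: "inner_D D (z t) v = (\<Sum>n<N. exp (- M t n) * (y n * inner_D D (x n) v))"
  by (simp add: z_def inner_neg_grad M_def mult.assoc)

text \<open>Pairing with the limiting separator shows that the terms of the residual cannot cancel;
  with Cauchy-Schwarz the residual norm is bounded below by a multiple of the loss.\<close>

lemma sum_exp_le: "\<mu>0 * (\<Sum>n<N. exp (- M t n)) \<le> inner_D D (z t) wbar"
  unfolding inner_z sum_distrib_left
  by (intro sum_mono) (use \<mu>0_le in \<open>auto simp: \<mu>_def mult.commute\<close>)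

lemma sum_exp_pos: "(\<Sum>n<N. exp (- M t n)) > 0"
  using index_nonempty by (intro sum_pos) auto

lemma nz_pos: "nz t > 0"
proof -
  have "0 < \<mu>0 * (\<Sum>n<N. exp (- M t n))" using \<mu>0_pos sum_exp_pos by simp
  also have "\<dots> \<le> nz t * vnorm D wbar"
    unfolding nz_def using sum_exp_le inner_le_vnorm order_trans by blast
  finally show ?thesis
    using vnorm_nonneg[of D wbar] by (simp add: zero_less_mult_iff)
qed

lemma exp_le_nz:
  assumes "n < N"
  shows "exp (- M t n) / nz t \<le> vnorm D wbar / \<mu>0"
proof -
  have "exp (- M t n) \<le> (\<Sum>n<N. exp (- M t n))"
    using assms by (intro member_le_sum) auto
  then have "\<mu>0 * exp (- M t n) \<le> nz t * vnorm D wbar"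
    unfolding nz_def using \<mu>0_pos sum_exp_le[of t] inner_le_vnorm[of D "z t" wbar]
    by (smt (verit) mult_left_mono)
  then show ?thesis using \<mu>0_pos nz_pos[of t] by (simp add: field_simps)
qed

text \<open>The reverse comparison with the loss, obtained by pairing the residual with
  itself.\<close>

lemma nz_le_sum_exp: "nz t \<le> (\<Sum>n<N. exp (- M t n)) * (\<Sum>n<N. vnorm D (\<lambda>k. y n * x n k))"
proof -
  define a where "a n = (\<lambda>k. y n * x n k)" for n
  define A where "A = (\<Sum>n<N. vnorm D (a n))"
  have "(nz t)\<^sup>2 = (\<Sum>n<N. exp (- M t n) * inner_D D (a n) (z t))"
    unfolding nz_def vnorm_sq inner_z by (simp add: a_def inner_D_def sum_distrib_left mult.assoc)
  also have "\<dots> \<le> (\<Sum>n<N. exp (- M t n) * (A * nz t))"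
  proof (intro sum_mono mult_left_mono)
    fix n assume "n \<in> {..<N}"
    then have "vnorm D (a n) \<le> A" unfolding A_def by (intro member_le_sum) auto
    then have "vnorm D (a n) * nz t \<le> A * nz t"
      using nz_pos[of t] by (intro mult_right_mono) auto
    then show "inner_D D (a n) (z t) \<le> A * nz t"
      using inner_le_vnorm[of D "a n" "z t"] by (simp add: nz_def)
  qed simp
  also have "\<dots> = (\<Sum>n<N. exp (- M t n)) * A * nz t"
    by (simp add: sum_distrib_right mult.assoc)
  finally have "nz t \<le> (\<Sum>n<N. exp (- M t n)) * A"
    using nz_pos[of t] by (simp add: power2_eq_square)
  then show ?thesis by (simp add: A_def a_def)
qed

lemma z_lim:
  assumes "k < D"
  shows "(\<lambda>t. z t k / nz t) \<longlonglongrightarrow> zb k"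
proof -
  have g: "grad_w D N x y (P_conv D L (u t)) k = - z t k" if "k < D" for t k
    using grad_w_eq[OF that] by (simp add: z_def w_def)
  have "vnorm D (grad_w D N x y (P_conv D L (u t))) = nz t" for t
  proof -
    have "vnorm D (grad_w D N x y (P_conv D L (u t))) = vnorm D (\<lambda>k. - z t k)"
      using g by (intro vnorm_cong)
    then show ?thesis by (simp add: vnorm_minus nz_def)
  qed
  then have "(\<lambda>t. - (z t k / nz t)) \<longlonglongrightarrow> g k"
    using grad_dir[OF assms] by (simp add: g assms)
  then show ?thesis
    unfolding zb_def using tendsto_minus by fastforce
qed

lemma Z_lim: "(\<lambda>t. Z t d / of_real (nz t)) \<longlonglongrightarrow> Zb d"
proof -
  have "(\<lambda>t. dft D (\<lambda>k. z t k / nz t) d) \<longlonglongrightarrow> Zb d"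
    unfolding Zb_def by (intro dft_tendsto z_lim)
  moreover have "dft D (\<lambda>k. z t k / nz t) d = Z t d / of_real (nz t)" for t
    using dft_scale[of D "1 / nz t" "z t" d] by (simp add: Z_def)
  ultimately show ?thesis by simp
qed

text \<open>The two comparisons with the loss give a lower bound independent of \<open>t\<close>,
  which survives the limit. This is what makes \<open>\<kappa>\<close> nonzero.\<close>

lemma inner_zb_wbar_pos: "inner_D D zb wbar > 0"
proof -
  define C where "C = (\<Sum>n<N. vnorm D (\<lambda>k. y n * x n k))"
  have C: "C > 0"
    using nz_pos[of 0] nz_le_sum_exp[of 0] sum_exp_pos[of 0] unfolding C_def[symmetric]
    by (smt (verit) mult_nonneg_nonpos)
  have "(\<lambda>t. \<Sum>k<D. (z t k / nz t) * wbar k) \<longlonglongrightarrow> inner_D D zb wbar"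
    unfolding inner_D_def by (intro tendsto_intros z_lim) simp
  moreover have "\<mu>0 / C \<le> (\<Sum>k<D. (z t k / nz t) * wbar k)" for t
  proof -
    have "\<mu>0 * nz t \<le> \<mu>0 * (\<Sum>n<N. exp (- M t n)) * C"
      using nz_le_sum_exp[of t] \<mu>0_pos by (simp add: C_def mult.assoc)
    also have "\<dots> \<le> inner_D D (z t) wbar * C"
      using sum_exp_le C by (intro mult_right_mono) auto
    finally have "\<mu>0 / C \<le> inner_D D (z t) wbar / nz t"
      using C nz_pos[of t] by (simp add: field_simps)
    then show ?thesis by (simp add: inner_D_def sum_divide_distrib)
  qed
  ultimately have "\<mu>0 / C \<le> inner_D D zb wbar" by (intro LIMSEQ_le_const) auto
  then show ?thesis using C \<mu>0_pos by (smt (verit) divide_pos_pos)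
qed

lemma dual_variables:
  obtains \<alpha> where "\<And>n. n < N \<Longrightarrow> \<alpha> n \<ge> 0" "\<And>n. n < N \<Longrightarrow> \<mu> n > \<mu>0 \<Longrightarrow> \<alpha> n = 0"
    "\<And>d. Zb d = (\<Sum>n<N. of_real (\<alpha> n * y n) * dft D (x n) d)"
proof -
  define a where "a t n = exp (- M t n) / nz t" for t n
  have a0: "0 \<le> a t n" for t n using nz_pos[of t] by (simp add: a_def)
  have "\<bar>a t n\<bar> \<le> vnorm D wbar / \<mu>0" if "n < N" for n t
    using exp_le_nz[OF that, of t] a0[of t n] by (simp add: a_def)
  from bounded_finite_family_convergent_subseq[of N a, OF this]
  obtain s \<alpha> where s: "strict_mono (s :: nat \<Rightarrow> nat)"
    and \<alpha>: "\<And>n. n < N \<Longrightarrow> (\<lambda>t. a (s t) n) \<longlonglongrightarrow> \<alpha> n"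
    by auto
  show thesis
  proof
    show "\<alpha> n \<ge> 0" if "n < N" for n
      using \<alpha>[OF that] a0 by (intro LIMSEQ_le_const) auto
    show "\<alpha> n = 0" if n: "n < N" "\<mu> n > \<mu>0" for n
    proof -
      \<comment> \<open>Compare with a point of least limiting margin: the gap of margins grows like
        a positive multiple of the predictor norm, so the ratio of the two weights vanishes.\<close>
      obtain m where m: "m < N" "\<mu> m = \<mu>0" using \<mu>0_attained by blast
      have "(\<lambda>t. M t n / vnorm D (w t) - M t m / vnorm D (w t)) \<longlonglongrightarrow> \<mu> n - \<mu> m"
        by (intro tendsto_intros M_lim)
      then have lim: "filterlim (\<lambda>t. (M t n / vnorm D (w t) - M t m / vnorm D (w t)) * vnorm D (w t)) at_top sequentially"
        using m n by (intro filterlim_tendsto_pos_mult_at_top[OF _ _ vnorm_w_at_top]) auto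
      have ev: "\<forall>\<^sub>F t in sequentially. (M t n / vnorm D (w t) - M t m / vnorm D (w t)) * vnorm D (w t) = M t n - M t m"
        using filterlim_at_top_dense[THEN iffD1, OF vnorm_w_at_top, rule_format, of 0]
        by eventually_elim (simp add: left_diff_distrib)
      have "filterlim (\<lambda>t. M t n - M t m) at_top sequentially"
        by (rule filterlim_cong[OF refl refl ev, THEN iffD1, OF lim])
      then have "(\<lambda>t. exp (- (M t n - M t m))) \<longlonglongrightarrow> 0"
        by (intro filterlim_compose[OF exp_at_bot]) (simp add: filterlim_uminus_at_bot)
      then have "(\<lambda>t. exp (- (M t n - M t m)) * (vnorm D wbar / \<mu>0)) \<longlonglongrightarrow> 0"
        by (rule tendsto_mult_left_zero)
      moreover have "norm (a t n) \<le> exp (- (M t n - M t m)) * (vnorm D wbar / \<mu>0)" for t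
      proof -
        have "a t n = exp (- (M t n - M t m)) * a t m"
          by (simp add: a_def flip: exp_add)
        moreover have "a t m \<le> vnorm D wbar / \<mu>0"
          using exp_le_nz[OF m(1), of t] by (simp add: a_def)
        ultimately show ?thesis
          using a0[of t n] mult_left_mono[of "a t m" "vnorm D wbar / \<mu>0" "exp (- (M t n - M t m))"]
          by simp
      qed
      ultimately have "(\<lambda>t. a t n) \<longlonglongrightarrow> 0"
        by (intro Lim_null_comparison[of "\<lambda>t. a t n"] always_eventually allI)
      from LIMSEQ_subseq_LIMSEQ[OF this s] have "(\<lambda>t. a (s t) n) \<longlonglongrightarrow> 0" by (simp add: o_def)
      then show ?thesis using \<alpha>[OF n(1)] LIMSEQ_unique by blast
    qed
    show "Zb d = (\<Sum>n<N. of_real (\<alpha> n * y n) * dft D (x n) d)" for d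
    proof -
      have "(\<lambda>t. \<Sum>n<N. of_real (a (s t) n * y n) * dft D (x n) d) \<longlonglongrightarrow> (\<Sum>n<N. of_real (\<alpha> n * y n) * dft D (x n) d)"
        by (intro tendsto_intros \<alpha>) simp
      moreover have "(\<Sum>n<N. of_real (a t n * y n) * dft D (x n) d) = Z t d / of_real (nz t)" for t
        by (simp add: a_def Z_eq sum_divide_distrib)
      moreover have "(\<lambda>t. Z (s t) d / of_real (nz (s t))) \<longlonglongrightarrow> Zb d"
        using LIMSEQ_subseq_LIMSEQ[OF Z_lim s] by (simp add: o_def)
      ultimately show ?thesis using LIMSEQ_unique by (simp only:)
    qed
  qed
qed

section \<open>Averaging the increments: stationarity in parameter space\<close>

definition b :: "nat \<Rightarrow> real" where "b t = \<eta> t * nz t * r t ^ (L - 1)"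

definition S :: "nat \<Rightarrow> real" where "S t = (\<Sum>s<t. b s)"

text \<open>The increment of \<open>U\<close> per unit of \<open>b\<close>. The weight
  \<open>b\<close> carries the size of the residual and of the \<open>L - 1\<close> other layers, so
  only directions remain and \<open>c\<close> converges.\<close>

definition c :: "nat \<Rightarrow> nat \<Rightarrow> nat \<Rightarrow> complex" where
  "c l d t = Z t d / of_real (nz t) * cnj (\<Prod>j\<in>{1..L} - {l}. U t j d / of_real (r t))"

definition V :: "nat \<Rightarrow> nat \<Rightarrow> complex" where
  "V l d = Zb d * cnj (\<Prod>j\<in>{1..L} - {l}. Ub j d)"

text \<open>Norm of the limiting increments, and by \<open>r_over_S_lim\<close> the limit of
  \<open>r t / S t\<close>.\<close>

definition \<kappa> :: real where "\<kappa> = sqrt (\<Sum>l\<in>{1..L}. \<Sum>d<D. (cmod (V l d))\<^sup>2)"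

lemma b_pos: "b t > 0"
  using eta_pos nz_pos r_pos by (simp add: b_def)

lemma U_increment:
  assumes "l \<in> {1..L}" "d < D"
  shows "U (Suc t) l d - U t l d = b t *\<^sub>R c l d t"
proof -
  have "(\<Prod>j\<in>{1..L} - {l}. U t j d / of_real (r t)) = (\<Prod>j\<in>{1..L} - {l}. U t j d) / of_real (r t ^ (L - 1))"
    using assms by (simp add: prod_dividef)
  then show ?thesis
    using assms r_pos[of t] nz_pos[of t] by (simp add: U_Suc c_def b_def scaleR_conv_of_real)
qed

lemma c_lim: "c l d \<longlonglongrightarrow> V l d"
  unfolding c_def V_def by (intro tendsto_intros Z_lim U_lim) simp

lemma norm_c_le_1:
  assumes "l \<in> {1..L}" "d < D"
  shows "cmod (c l d t) \<le> 1"
proof -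
  have "cmod (Z t d / of_real (nz t)) \<le> 1"
    using dft_le_vnorm[OF assms(2), of "z t"] nz_pos[of t] by (simp add: Z_def nz_def norm_divide)
  moreover have "(\<Prod>j\<in>{1..L} - {l}. cmod (U t j d / of_real (r t))) \<le> 1"
    using U_le_pnorm assms r_pos[of t] by (intro prod_le_1) (auto simp: norm_divide r_def)
  ultimately show ?thesis
    unfolding c_def norm_mult complex_mod_cnj prod_norm[symmetric] by (intro mult_le_one prod_nonneg) auto
qed

lemma U_bound:
  assumes "l \<in> {1..L}" "d < D"
  shows "cmod (U t l d) \<le> cmod (U 0 l d) + S t"
proof (induction t)
  case (Suc t)
  have "cmod (U (Suc t) l d) \<le> cmod (U t l d) + cmod (b t *\<^sub>R c l d t)"
    using U_increment[OF assms, of t] norm_triangle_ineq[of "U t l d" "b t *\<^sub>R c l d t"]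
    by (simp add: diff_eq_eq add.commute)
  also have "cmod (b t *\<^sub>R c l d t) \<le> b t"
    using norm_c_le_1[OF assms, of t] b_pos[of t] by (simp add: mult_left_le)
  finally show ?case using Suc by (simp add: S_def)
qed (simp add: S_def)

text \<open>Normalized increments have modulus at most 1, so the parameter norm grows at most
  linearly in \<open>S\<close>; since it diverges, \<open>S\<close> does.\<close>

lemma S_at_top: "filterlim S at_top sequentially"
proof -
  define A where "A = (\<Sum>l\<in>{1..L}. \<Sum>d<D. cmod (U 0 l d))"
  define B where "B = real L * real D"
  have B: "B > 0" using L1 D1 by (simp add: B_def)
  have "r t \<le> A + B * S t" for t
  proof -
    have "r t = L2_set (\<lambda>(l, d). cmod (U t l d)) ({1..L} \<times> {..<D})"
      using pnorm_sq_dft[of D L "u t"] r_pos[of t]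
      by (simp add: L2_set_def r_def U_def sum.cartesian_product case_prod_unfold real_sqrt_unique)
    also have "\<dots> \<le> (\<Sum>(l, d)\<in>{1..L} \<times> {..<D}. cmod (U t l d))"
      by (rule L2_set_le_sum) auto
    also have "\<dots> = (\<Sum>l\<in>{1..L}. \<Sum>d<D. cmod (U t l d))"
      by (simp add: sum.cartesian_product)
    also have "\<dots> \<le> (\<Sum>l\<in>{1..L}. \<Sum>d<D. cmod (U 0 l d) + S t)"
      using U_bound by (intro sum_mono) auto
    also have "\<dots> = A + B * S t" by (simp add: A_def B_def sum.distrib)
    finally show ?thesis .
  qed
  then have *: "(r t - A) / B \<le> S t" for t using B by (simp add: field_simps)
  show ?thesis
    unfolding filterlim_at_top
  proof
    fix Q
    have "\<forall>\<^sub>F t in sequentially. r t > Q * B + A"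
      using pnorm_at_top unfolding r_def filterlim_at_top_dense by blast
    then show "\<forall>\<^sub>F t in sequentially. Q \<le> S t"
    proof eventually_elim
      case (elim t)
      then have "Q \<le> (r t - A) / B" using B by (simp add: field_simps)
      then show ?case using * order_trans by blast
    qed
  qed
qed

lemma U_over_S_lim:
  assumes "l \<in> {1..L}" "d < D"
  shows "(\<lambda>t. U t l d / of_real (S t)) \<longlonglongrightarrow> V l d"
  using stolz_cesaro_weighted[OF _ _ U_increment[OF assms] c_lim] b_pos S_at_top
  unfolding S_def by (simp add: scaleR_conv_of_real divide_inverse mult.commute less_imp_le)

lemma r_over_S_lim: "(\<lambda>t. r t / S t) \<longlonglongrightarrow> \<kappa>"
proof -
  have S0: "S t \<ge> 0" for t using b_pos by (simp add: S_def sum_nonneg less_imp_le)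
  have "(\<lambda>t. sqrt (\<Sum>l\<in>{1..L}. \<Sum>d<D. (cmod (U t l d / of_real (S t)))\<^sup>2)) \<longlonglongrightarrow> \<kappa>"
    unfolding \<kappa>_def by (intro tendsto_intros U_over_S_lim) auto
  moreover have "sqrt (\<Sum>l\<in>{1..L}. \<Sum>d<D. (cmod (U t l d / of_real (S t)))\<^sup>2) = r t / S t" for t
  proof -
    have "(\<Sum>l\<in>{1..L}. \<Sum>d<D. (cmod (U t l d / of_real (S t)))\<^sup>2) = (r t / S t)\<^sup>2"
      by (simp add: norm_divide power_divide r_def pnorm_sq_dft U_def flip: sum_divide_distrib)
    then show ?thesis using r_pos[of t] S0[of t] by (simp add: real_sqrt_unique)
  qed
  ultimately show ?thesis by simp
qed

text \<open>The same sequence normalized by \<open>S\<close>, with limit from the averaging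
  argument, and by \<open>r\<close>; the two differ by the factor \<open>r t / S t\<close>.\<close>

lemma V_eq:
  assumes "l \<in> {1..L}" "d < D"
  shows "V l d = of_real \<kappa> * Ub l d"
proof -
  have "(\<lambda>t. of_real (r t / S t) * (U t l d / of_real (r t))) \<longlonglongrightarrow> of_real \<kappa> * Ub l d"
    by (intro tendsto_intros r_over_S_lim U_lim assms)
  moreover have "of_real (r t / S t) * (U t l d / of_real (r t)) = U t l d / of_real (S t)" for t
    using r_pos[of t] by simp
  ultimately show ?thesis using U_over_S_lim[OF assms] LIMSEQ_unique by (simp only:)
qed

text \<open>The parameter-space condition for layer 1, multiplied by the conjugate weight so that the
  layer index disappears.\<close>
lemma mode_stationary:
  assumes "d < D"
  shows "Zb d * cnj (\<Omega> d) = of_real (\<kappa> * (\<rho> d)\<^sup>2)"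
proof -
  have 1: "1 \<in> {1..L}" using L1 by simp
  have "\<Omega> d = Ub 1 d * (\<Prod>j\<in>{1..L} - {1}. Ub j d)"
    unfolding \<Omega>_def by (rule prod.remove[OF _ 1]) simp
  then have "Zb d * cnj (\<Omega> d) = V 1 d * cnj (Ub 1 d)" by (simp add: V_def)
  also have "\<dots> = of_real \<kappa> * (Ub 1 d * cnj (Ub 1 d))" using V_eq[OF 1 assms] by simp
  also have "\<dots> = of_real (\<kappa> * (\<rho> d)\<^sup>2)"
    by (simp add: \<rho>_def complex_norm_square[symmetric])
  finally show ?thesis .
qed

text \<open>If \<open>\<kappa>\<close> were zero, Parseval and \<open>mode_stationary\<close> would
  make the residual direction orthogonal to \<open>wbar\<close>.\<close>

lemma \<kappa>_pos: "\<kappa> > 0"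
proof -
  have "of_real (inner_D D zb wbar) = (\<Sum>d<D. Zb d * cnj (\<Omega> d)) / of_real K"
    unfolding parseval Zb_def[symmetric] by (simp add: dft_wbar sum_divide_distrib)
  also have "\<dots> = of_real (\<kappa> * (\<Sum>d<D. (\<rho> d)\<^sup>2) / K)"
    by (simp add: mode_stationary sum_distrib_left)
  finally have "inner_D D zb wbar = \<kappa> * (\<Sum>d<D. (\<rho> d)\<^sup>2) / K" by (simp only: of_real_eq_iff)
  then have "\<kappa> \<noteq> 0" using inner_zb_wbar_pos by auto
  moreover have "\<kappa> \<ge> 0" by (simp add: \<kappa>_def sum_nonneg)
  ultimately show ?thesis by simp
qed

end

section \<open>Dominated frequencies of two-layer networks\<close>

text \<open>If \<open>h\<close> equals \<open>a * \<xi>\<close> with \<open>a \<ge> 0\<close>, then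
  \<open>U1 + \<xi> * cnj U2\<close> is multiplied by \<open>1 + a\<close> and
  \<open>U1 - \<xi> * cnj U2\<close> by \<open>1 - a\<close>. Small phase errors preserve the cone
  where the second is no larger than the first, and inside it the first grows at nearly full rate.
  The \<open>p\<close> obtained is the modulus of the first.\<close>

lemma cone_growth:
  fixes U1 U2 h :: "nat \<Rightarrow> complex" and \<xi> :: complex and \<epsilon> :: real
  assumes U1: "\<And>t. U1 (Suc t) = U1 t + h t * cnj (U2 t)"
    and U2: "\<And>t. U2 (Suc t) = U2 t + h t * cnj (U1 t)"
    and h_lt: "\<And>t. cmod (h t) < 1"
    and init: "cmod (U1 0) \<noteq> cmod (U2 0)"
    and \<xi>: "cmod \<xi> = 1" and \<epsilon>: "0 < \<epsilon>" "\<epsilon> \<le> 1/2"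
    and h_half: "\<And>t. t \<ge> T0 \<Longrightarrow> cmod (h t) \<le> 1/2"
    and h_dir: "\<And>t. t \<ge> T0 \<Longrightarrow> cmod (h t - of_real (cmod (h t)) * \<xi>) \<le> \<epsilon> / 2 * cmod (h t)"
    and diverge: "filterlim (\<lambda>t. \<Sum>s<t. cmod (h s)) at_top sequentially"
  obtains p :: "nat \<Rightarrow> real" and T where "T \<ge> T0" "p T > 0"
    "\<And>t. t \<ge> T \<Longrightarrow> p (Suc t) \<ge> (1 + (1 - \<epsilon>) * cmod (h t)) * p t"
    "\<And>t. p t \<le> cmod (U1 t) + cmod (U2 t)"
proof -
  define a where "a t = cmod (h t)" for t
  define p where "p t = U1 t + \<xi> * cnj (U2 t)" for t
  define m where "m t = U1 t - \<xi> * cnj (U2 t)" for t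
  define \<Delta> where "\<Delta> t = (cmod (U1 t))\<^sup>2 - (cmod (U2 t))\<^sup>2" for t
  have a0: "0 \<le> a t" and a1: "a t < 1" for t using h_lt by (simp_all add: a_def)
  have \<Delta>_step: "\<Delta> (Suc t) = \<Delta> t * (1 - (a t)\<^sup>2)" for t
    unfolding \<Delta>_def U1 U2 a_def by (rule norm_sq_diff_step)
  have a_sq: "0 < 1 - (a t)\<^sup>2" for t
    using a0[of t] a1[of t] by (simp add: power_less_one_iff abs_square_less_1)
  have \<Delta>_nz: "\<Delta> t \<noteq> 0" for t
  proof (induction t)
    case 0
    then show ?case using init by (simp add: \<Delta>_def)
  next
    case (Suc t)
    then show ?case using a_sq[of t] by (simp add: \<Delta>_step)
  qed
  have \<xi>\<xi>: "\<xi> * cnj \<xi> = 1" using \<xi> by (simp add: complex_norm_square[symmetric])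
  have U_le: "cmod (U1 t) + cmod (U2 t) \<le> cmod (p t) + cmod (m t)" for t
  proof -
    have "2 * cmod (U1 t) = cmod (p t + m t)"
      by (simp add: p_def m_def norm_mult flip: mult_2)
    also have "\<dots> \<le> cmod (p t) + cmod (m t)" by (rule norm_triangle_ineq)
    finally have 1: "2 * cmod (U1 t) \<le> cmod (p t) + cmod (m t)" .
    have "p t - m t = 2 * (\<xi> * cnj (U2 t))" by (simp add: p_def m_def)
    then have "2 * cmod (U2 t) = cmod (p t - m t)"
      using \<xi> by (simp add: norm_mult)
    also have "\<dots> \<le> cmod (p t) + cmod (m t)" by (rule norm_triangle_ineq4)
    finally show ?thesis using 1 by simp
  qed
  have err: "cmod (p (Suc t) - of_real (1 + a t) * p t) \<le> \<epsilon> / 2 * a t * (cmod (p t) + cmod (m t))"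
    "cmod (m (Suc t) - of_real (1 - a t) * m t) \<le> \<epsilon> / 2 * a t * (cmod (p t) + cmod (m t))"
    if t: "t \<ge> T0" for t
  proof -
    define k where "k = h t - of_real (a t) * \<xi>"
    have h: "h t = of_real (a t) * \<xi> + k" by (simp add: k_def)
    have k: "cmod k \<le> \<epsilon> / 2 * a t" unfolding k_def a_def by (rule h_dir[OF t])
    have \<xi>c: "\<xi> * (cnj \<xi> * c) = c" for c using \<xi>\<xi> by (simp flip: mult.assoc)
    have eqs: "p (Suc t) - of_real (1 + a t) * p t = k * cnj (U2 t) + \<xi> * cnj k * U1 t"
      "m (Suc t) - of_real (1 - a t) * m t = k * cnj (U2 t) - \<xi> * cnj k * U1 t"
      unfolding p_def m_def U1 U2 h by (simp_all add: algebra_simps \<xi>c)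
    have "cmod (k * cnj (U2 t) + \<xi> * cnj k * U1 t) \<le> cmod k * (cmod (U1 t) + cmod (U2 t))"
      "cmod (k * cnj (U2 t) - \<xi> * cnj k * U1 t) \<le> cmod k * (cmod (U1 t) + cmod (U2 t))"
      using norm_triangle_ineq[of "k * cnj (U2 t)" "\<xi> * cnj k * U1 t"]
        norm_triangle_ineq4[of "k * cnj (U2 t)" "\<xi> * cnj k * U1 t"] \<xi>
      by (simp_all add: norm_mult algebra_simps)
    moreover have "cmod k * (cmod (U1 t) + cmod (U2 t)) \<le> (\<epsilon> / 2 * a t) * (cmod (p t) + cmod (m t))"
      using k U_le \<epsilon> a0[of t] by (intro mult_mono) auto
    ultimately show "cmod (p (Suc t) - of_real (1 + a t) * p t) \<le> \<epsilon> / 2 * a t * (cmod (p t) + cmod (m t))"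
      "cmod (m (Suc t) - of_real (1 - a t) * m t) \<le> \<epsilon> / 2 * a t * (cmod (p t) + cmod (m t))"
      unfolding eqs by linarith+
  qed
  have p_ge: "cmod (p (Suc t)) \<ge> (1 + a t) * cmod (p t) - \<epsilon> / 2 * a t * (cmod (p t) + cmod (m t))"
    and m_le: "cmod (m (Suc t)) \<le> (1 - a t) * cmod (m t) + \<epsilon> / 2 * a t * (cmod (p t) + cmod (m t))"
    if "t \<ge> T0" for t
  proof -
    have "cmod (of_real (1 + a t) * p t) = (1 + a t) * cmod (p t)"
      "cmod (of_real (1 - a t) * m t) = (1 - a t) * cmod (m t)"
      using a0[of t] a1[of t] by (simp_all add: norm_mult del: of_real_add of_real_diff)
    then show "cmod (p (Suc t)) \<ge> (1 + a t) * cmod (p t) - \<epsilon> / 2 * a t * (cmod (p t) + cmod (m t))"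
      "cmod (m (Suc t)) \<le> (1 - a t) * cmod (m t) + \<epsilon> / 2 * a t * (cmod (p t) + cmod (m t))"
      using err[OF that] norm_triangle_ineq3[of "p (Suc t)" "of_real (1 + a t) * p t"]
        norm_triangle_ineq2[of "m (Suc t)" "of_real (1 - a t) * m t"]
      by linarith+
  qed
  \<comment> \<open>Outside the cone \<open>\<bar>\<Delta>\<bar>\<close> is at most twice the square
    of \<open>cmod m\<close>. But there \<open>m\<close> shrinks to first order in \<open>a\<close>
    and \<open>\<Delta>\<close> only to second order, so the ratio \<open>f\<close> would decay to
    0.\<close>
  have "\<exists>T\<ge>T0. cmod (m T) \<le> cmod (p T)"
  proof (rule ccontr)
    assume "\<not> (\<exists>T\<ge>T0. cmod (m T) \<le> cmod (p T))"
    then have pm: "cmod (p t) < cmod (m t)" if "t \<ge> T0" for t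
      using that by (meson not_le)
    define f where "f t = (cmod (m t))\<^sup>2 / \<bar>\<Delta> t\<bar>" for t
    define S where "S t = (\<Sum>s<t. a s)" for t
    have f_ge: "f t \<ge> 1 / 2" if t: "t \<ge> T0" for t
    proof -
      have "\<bar>\<Delta> t\<bar> = \<bar>cmod (U1 t) - cmod (U2 t)\<bar> * (cmod (U1 t) + cmod (U2 t))"
        by (simp add: \<Delta>_def power2_eq_square square_diff_square_factored abs_mult mult.commute)
      also have "\<dots> \<le> cmod (p t) * (cmod (p t) + cmod (m t))"
      proof (intro mult_mono U_le)
        have "cmod (- (\<xi> * cnj (U2 t))) = cmod (U2 t)" using \<xi> by (simp add: norm_mult)
        then show "\<bar>cmod (U1 t) - cmod (U2 t)\<bar> \<le> cmod (p t)"
          using norm_triangle_ineq3[of "U1 t" "- (\<xi> * cnj (U2 t))"] by (simp add: p_def)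
      qed auto
      also have "\<dots> \<le> cmod (m t) * (2 * cmod (m t))"
        using pm[OF t] by (intro mult_mono) auto
      finally have "\<bar>\<Delta> t\<bar> \<le> 2 * (cmod (m t))\<^sup>2" by (simp add: power2_eq_square)
      then show ?thesis using \<Delta>_nz[of t] by (simp add: f_def field_simps)
    qed
    have f_step: "f (Suc t) \<le> f t * exp (- a t / 4)" if t: "t \<ge> T0" for t
    proof -
      have ah: "a t \<le> 1 / 2" using h_half[OF t] by (simp add: a_def)
      have "cmod (m (Suc t)) \<le> (1 - a t) * cmod (m t) + \<epsilon> / 2 * a t * (cmod (p t) + cmod (m t))"
        by (rule m_le[OF t])
      also have "\<dots> \<le> (1 - a t) * cmod (m t) + 1 / 4 * a t * (2 * cmod (m t))"
        using pm[OF t] \<epsilon> a0[of t] by (intro add_left_mono mult_mono) auto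
      finally have "cmod (m (Suc t)) \<le> (1 - a t / 2) * cmod (m t)" by (simp add: algebra_simps)
      then have "(cmod (m (Suc t)))\<^sup>2 \<le> ((1 - a t / 2) * cmod (m t))\<^sup>2"
        by (intro power_mono) auto
      then have m2: "(cmod (m (Suc t)))\<^sup>2 \<le> (1 - a t / 2)\<^sup>2 * (cmod (m t))\<^sup>2"
        by (simp add: power_mult_distrib)
      \<comment> \<open>The rate \<open>1 - a / 4\<close> leaves slack below the first-order decay
        of \<open>(1 - a / 2)\<^sup>2\<close>. The bound \<open>a \<le> 1 / 2\<close> keeps the last
        bracket nonnegative; near \<open>a = 1\<close> the comparison fails.\<close>
      have "(1 - a t / 4) * (1 - (a t)\<^sup>2) - (1 - a t / 2)\<^sup>2 = a t * (3 / 4 - 5 / 4 * a t + (a t)\<^sup>2 / 4)"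
        by (simp add: field_simps power2_eq_square)
      moreover have "0 \<le> a t * (3 / 4 - 5 / 4 * a t + (a t)\<^sup>2 / 4)"
        using a0[of t] ah zero_le_power2[of "a t"] by (intro mult_nonneg_nonneg) linarith+
      ultimately have "(1 - a t / 2)\<^sup>2 \<le> (1 - a t / 4) * (1 - (a t)\<^sup>2)" by linarith
      also have "\<dots> \<le> exp (- a t / 4) * (1 - (a t)\<^sup>2)"
        using a_sq[of t] exp_ge_add_one_self[of "- a t / 4"] by (intro mult_right_mono) auto
      finally have "(1 - a t / 2)\<^sup>2 * (cmod (m t))\<^sup>2 \<le> exp (- a t / 4) * (1 - (a t)\<^sup>2) * (cmod (m t))\<^sup>2"
        by (intro mult_right_mono) auto
      with m2 have "(cmod (m (Suc t)))\<^sup>2 \<le> exp (- a t / 4) * (1 - (a t)\<^sup>2) * (cmod (m t))\<^sup>2" by linarith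
      then have "f (Suc t) \<le> exp (- a t / 4) * (1 - (a t)\<^sup>2) * (cmod (m t))\<^sup>2 / \<bar>\<Delta> (Suc t)\<bar>"
        unfolding f_def by (intro divide_right_mono) auto
      also have "\<dots> = f t * exp (- a t / 4)"
        using a_sq[of t] by (simp add: f_def \<Delta>_step abs_mult)
      finally show ?thesis .
    qed
    have f_le: "f t \<le> f T0 * exp (- (S t - S T0) / 4)" if "t \<ge> T0" for t
      using that
    proof (induction t rule: dec_induct)
      case (step t)
      have "f (Suc t) \<le> f t * exp (- a t / 4)" using step by (intro f_step)
      also have "\<dots> \<le> f T0 * exp (- (S t - S T0) / 4) * exp (- a t / 4)"
        using step by (intro mult_right_mono) auto
      also have "\<dots> = f T0 * exp (- (S (Suc t) - S T0) / 4)"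
        by (simp add: S_def mult.assoc field_simps flip: exp_add)
      finally show ?case .
    qed simp
    have f_pos: "f T0 > 0" using f_ge[of T0] by simp
    \<comment> \<open>The increase of \<open>S\<close> at which the decaying bound on
      \<open>f\<close> reaches \<open>1 / 2\<close>.\<close>
    have "\<forall>\<^sub>F t in sequentially. S t > S T0 + 4 * ln (2 * f T0) \<and> t \<ge> T0"
      using diverge unfolding S_def a_def filterlim_at_top_dense
      by (intro eventually_conj eventually_ge_at_top) auto
    then obtain t where t: "S t > S T0 + 4 * ln (2 * f T0)" "t \<ge> T0"
      using eventually_happens'[OF sequentially_bot] by blast
    have "f T0 * exp (- (S t - S T0) / 4) < f T0 * exp (- ln (2 * f T0))"
      using t f_pos by simp
    also have "\<dots> = 1 / 2" using f_pos by (simp add: exp_minus field_simps)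
    finally show False using f_le[OF t(2)] f_ge[OF t(2)] by linarith
  qed
  then obtain T where T: "T \<ge> T0" "cmod (m T) \<le> cmod (p T)" by blast
  have grow: "(1 + (1 - \<epsilon>) * a t) * cmod (p t) \<le> cmod (p (Suc t))"
    if "t \<ge> T0" "cmod (m t) \<le> cmod (p t)" for t
  proof -
    have "\<epsilon> / 2 * a t * (cmod (p t) + cmod (m t)) \<le> \<epsilon> / 2 * a t * (2 * cmod (p t))"
      using that \<epsilon> a0[of t] by (intro mult_left_mono) auto
    moreover have "(1 + a t) * cmod (p t) - \<epsilon> / 2 * a t * (2 * cmod (p t)) = (1 + (1 - \<epsilon>) * a t) * cmod (p t)"
      by (simp add: algebra_simps)
    ultimately show ?thesis using p_ge[OF that(1)] by linarith
  qed
  have cone: "cmod (m t) \<le> cmod (p t)" if "t \<ge> T" for t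
    using that
  proof (induction t rule: dec_induct)
    case base
    show ?case by (rule T)
  next
    case (step t)
    have t: "t \<ge> T0" using step T by simp
    have "cmod (m (Suc t)) \<le> (1 - a t) * cmod (m t) + \<epsilon> / 2 * a t * (cmod (p t) + cmod (m t))"
      by (rule m_le[OF t])
    also have "\<dots> \<le> (1 - a t) * cmod (p t) + \<epsilon> / 2 * a t * (2 * cmod (p t))"
      using step \<epsilon> a0[of t] a1[of t] by (intro add_mono mult_left_mono) auto
    also have "\<dots> = (1 - (1 - \<epsilon>) * a t) * cmod (p t)" by (simp add: algebra_simps)
    also have "\<dots> \<le> (1 + (1 - \<epsilon>) * a t) * cmod (p t)"
      using \<epsilon> a0[of t] by (intro mult_right_mono) auto
    also have "\<dots> \<le> cmod (p (Suc t))" using step t by (intro grow)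
    finally show ?case .
  qed
  show thesis
  proof
    show "T \<ge> T0" by (rule T)
    show "cmod (p T) > 0"
    proof (rule ccontr)
      assume "\<not> cmod (p T) > 0"
      then have "cmod (p T) = 0" "cmod (m T) = 0" using T by auto
      then have "cmod (U1 T) = 0" "cmod (U2 T) = 0"
        using U_le[of T] norm_ge_zero[of "U1 T"] norm_ge_zero[of "U2 T"] by linarith+
      then show False using \<Delta>_nz[of T] by (simp add: \<Delta>_def)
    qed
    show "cmod (p (Suc t)) \<ge> (1 + (1 - \<epsilon>) * cmod (h t)) * cmod (p t)" if "t \<ge> T" for t
      using grow[of t] cone[OF that] that T by (simp add: a_def)
    show "cmod (p t) \<le> cmod (U1 t) + cmod (U2 t)" for t
      using norm_triangle_ineq[of "U1 t" "\<xi> * cnj (U2 t)"] \<xi> by (simp add: p_def norm_mult)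
  qed
qed

context conv_gd_limit
begin

lemma M_lim_r: "(\<lambda>t. M t n / r t ^ L) \<longlonglongrightarrow> K * \<mu> n"
proof -
  have "(\<lambda>t. (vnorm D (w t) / r t ^ L) * (M t n / vnorm D (w t))) \<longlonglongrightarrow> K * \<mu> n"
    by (intro tendsto_mult vnorm_w_lim M_lim)
  moreover have "\<forall>\<^sub>F t in sequentially. (vnorm D (w t) / r t ^ L) * (M t n / vnorm D (w t)) = M t n / r t ^ L"
    using filterlim_at_top_dense[THEN iffD1, OF vnorm_w_at_top, rule_format, of 0]
    by eventually_elim simp
  ultimately show ?thesis by (rule Lim_transform_eventually)
qed

lemma r_at_top: "filterlim r at_top sequentially"
  using pnorm_at_top unfolding r_def .

text \<open>The radial second derivative is at least of order loss times \<open>r t ^ 4\<close>,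
  while the Lipschitz bound allows only \<open>\<beta> * (r t)\<^sup>2\<close>. Hence
  \<open>\<eta> t\<close> times the loss is of order \<open>1 / (r t)\<^sup>2\<close>, and the
  residual is at most a multiple of the loss.\<close>

lemma step_vanishes:
  assumes L: "L = 2" and d: "d < D"
  shows "(\<lambda>t. \<eta> t * cmod (Z t d)) \<longlonglongrightarrow> 0"
proof -
  define C where "C = (\<Sum>n<N. vnorm D (\<lambda>k. y n * x n k))"
  \<comment> \<open>Half the least limit of \<open>M t n / (r t)\<^sup>2\<close>, hence eventually a
    lower bound for it at every data point.\<close>
  define \<gamma> where "\<gamma> = K * \<mu>0 / 2"
  have \<gamma>: "\<gamma> > 0" using K_pos \<mu>0_pos by (simp add: \<gamma>_def)
  have C0: "C \<ge> 0" by (simp add: C_def sum_nonneg)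
  have Mn: "\<forall>\<^sub>F t in sequentially. \<gamma> * (r t)\<^sup>2 \<le> M t n \<and> 1 \<le> M t n" if n: "n < N" for n
  proof -
    have "K * \<mu> n > \<gamma>"
      using \<mu>0_le[OF n] K_pos \<mu>0_pos mult_left_mono[of \<mu>0 "\<mu> n" K] mult_pos_pos[of K \<mu>0]
      unfolding \<gamma>_def by linarith
    then have "\<forall>\<^sub>F t in sequentially. M t n / r t ^ L > \<gamma>"
      using order_tendstoD(1)[OF M_lim_r] by blast
    moreover have "\<forall>\<^sub>F t in sequentially. M t n > 1"
      using margin_at_top[OF n] unfolding filterlim_at_top_dense by blast
    ultimately show ?thesis
    proof eventually_elim
      case (elim t)
      then show ?case using r_pos[of t] L by (simp add: pos_less_divide_eq)
    qed
  qed
  have "\<forall>\<^sub>F t in sequentially. \<forall>n\<in>{..<N}. \<gamma> * (r t)\<^sup>2 \<le> M t n \<and> 1 \<le> M t n"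
    by (intro eventually_ball_finite ballI) (use Mn in auto)
  then have "\<forall>\<^sub>F t in sequentially. norm (\<eta> t * cmod (Z t d)) \<le> C / (2 * \<gamma>\<^sup>2) / (r t)\<^sup>2"
  proof eventually_elim
    case (elim t)
    define E where "E = (\<Sum>n<N. exp (- M t n))"
    obtain R \<beta> where *: "R > 0" "\<beta> \<ge> 0" "\<eta> t * \<beta> < 1" "local_lipschitz_grad D L N x y (u t) R \<beta>"
      by (rule local_lipschitz)
    have lip2: "local_lipschitz_grad D 2 N x y (u t) R \<beta>" using *(4) L by simp
    have M2: "M t n = y n * inner_D D (x n) (P_conv D 2 (u t))" for n
      unfolding M_def w_def by (simp only: L)
    have r2: "r t = pnorm D 2 (u t)" unfolding r_def by (simp only: L)
    have "E * (2 * \<gamma>\<^sup>2 * (r t) ^ 4) \<le> (\<Sum>n<N. exp (- M t n) * (4 * (M t n)\<^sup>2 - 2 * M t n))"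
      unfolding E_def sum_distrib_right
    proof (intro sum_mono mult_left_mono)
      fix n assume "n \<in> {..<N}"
      then have M: "\<gamma> * (r t)\<^sup>2 \<le> M t n" "1 \<le> M t n" using elim by auto
      have "(\<gamma> * (r t)\<^sup>2)\<^sup>2 \<le> (M t n)\<^sup>2" using M \<gamma> by (intro power_mono) auto
      then have "\<gamma>\<^sup>2 * (r t) ^ 4 \<le> (M t n)\<^sup>2" by (simp add: power_mult_distrib flip: power_mult)
      \<comment> \<open>A margin of at least 1 lets half of the quadratic term absorb the linear
        one.\<close>
      moreover have "M t n \<le> (M t n)\<^sup>2" using M by (simp add: power2_eq_square)
      ultimately show "2 * \<gamma>\<^sup>2 * (r t) ^ 4 \<le> 4 * (M t n)\<^sup>2 - 2 * M t n" by linarith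
    qed simp
    also have "\<dots> \<le> \<beta> * (r t)\<^sup>2"
      using radial_curvature[OF lip2 *(1) y_sq] unfolding M2 r2 by simp
    finally have "\<eta> t * (E * (2 * \<gamma>\<^sup>2 * (r t) ^ 4)) \<le> \<eta> t * (\<beta> * (r t)\<^sup>2)"
      using eta_pos[of t] by (intro mult_left_mono) auto
    also have "\<dots> \<le> 1 * (r t)\<^sup>2"
      unfolding mult.assoc[symmetric] using * by (intro mult_right_mono) auto
    finally have "(\<eta> t * E * (2 * \<gamma>\<^sup>2 * (r t)\<^sup>2)) * (r t)\<^sup>2 \<le> 1 * (r t)\<^sup>2"
      by (simp add: power4_eq_xxxx power2_eq_square mult_ac)
    then have "\<eta> t * E * (2 * \<gamma>\<^sup>2 * (r t)\<^sup>2) \<le> 1"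
      using r_pos[of t] by (simp del: mult_1)
    then have \<eta>E: "\<eta> t * E \<le> 1 / (2 * \<gamma>\<^sup>2 * (r t)\<^sup>2)"
      using r_pos[of t] \<gamma> by (simp add: pos_le_divide_eq)
    have "cmod (Z t d) \<le> E * C"
      using dft_le_vnorm[OF d, of "z t"] nz_le_sum_exp[of t] unfolding E_def C_def Z_def nz_def by linarith
    then have "\<eta> t * cmod (Z t d) \<le> \<eta> t * E * C"
      using eta_pos[of t] by (simp add: mult.assoc)
    also have "\<dots> \<le> 1 / (2 * \<gamma>\<^sup>2 * (r t)\<^sup>2) * C"
      using \<eta>E C0 by (rule mult_right_mono)
    finally show ?case using eta_pos[of t] by (simp add: abs_mult mult.commute)
  qed
  moreover have "(\<lambda>t. C / (2 * \<gamma>\<^sup>2) / (r t)\<^sup>2) \<longlonglongrightarrow> 0"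
    by (intro tendsto_divide_0[OF tendsto_const] filterlim_at_top_imp_at_infinity
        filterlim_pow_at_top[OF _ r_at_top]) simp
  ultimately show ?thesis by (rule Lim_null_comparison)
qed

text \<open>Moduli in \<open>mode_stationary\<close>, where two layers give
  \<open>cmod (\<Omega> d) = (\<rho> d)\<^sup>2\<close>.\<close>

lemma norm_Zb_active:
  assumes L: "L = 2" and d: "d < D" "\<rho> d > 0"
  shows "cmod (Zb d) = \<kappa>"
proof -
  have "cmod (Zb d) * (\<rho> d)\<^sup>2 = \<kappa> * (\<rho> d)\<^sup>2"
    using arg_cong[OF mode_stationary[OF d(1)], of cmod] norm_\<Omega>[OF d(1)] L \<kappa>_pos
    by (simp add: norm_mult norm_power)
  then show ?thesis using d by simp
qed

text \<open>A frequency that dies out in the limit direction cannot carry a dominant gradient: unless the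
  two layers start exactly balanced there, it would outgrow every active frequency.\<close>
lemma norm_Zb_le:
  assumes L: "L = 2" and d': "d' < D" and init: "cmod (U 0 1 d') \<noteq> cmod (U 0 2 d')"
  shows "cmod (Zb d') \<le> \<kappa>"
proof (cases "\<rho> d' > 0")
  case True
  then show ?thesis using norm_Zb_active[OF L d'] by simp
next
  case False
  then have \<rho>0: "\<rho> d' = 0" by (simp add: \<rho>_def)
  show ?thesis
  proof (rule ccontr)
    assume "\<not> cmod (Zb d') \<le> \<kappa>"
    then have big: "\<kappa> < cmod (Zb d')" by simp
    obtain d where d: "d < D" "\<rho> d > 0" using exists_active by blast
    have 12: "1 \<in> {1..L}" "2 \<in> {1..L}" "{1..L} - {1} = {2}" "{1..L} - {2} = {1}" "{1..L} - {1, 2} = {}"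
      using L by auto
    have U1: "U (Suc t) 1 e = U t 1 e + of_real (\<eta> t) * Z t e * cnj (U t 2 e)"
      and U2: "U (Suc t) 2 e = U t 2 e + of_real (\<eta> t) * Z t e * cnj (U t 1 e)"
      if "e < D" for t e
      using U_Suc[OF 12(1) that] U_Suc[OF 12(2) that] unfolding 12(3,4) by simp_all
    define h where "h t = of_real (\<eta> t) * Z t d'" for t
    define \<xi> where "\<xi> = sgn (Zb d')"
    \<comment> \<open>The relative excess of the residual over \<open>\<kappa>\<close>. Taking
      \<open>\<epsilon>\<close> below it retains a gap between the growth rates; the cap
      \<open>1 / 2\<close> is demanded by \<open>cone_growth\<close>.\<close>
    define \<theta> where "\<theta> = 1 - \<kappa> / cmod (Zb d')"
    define \<epsilon> where "\<epsilon> = min (1 / 2) (\<theta> / 2)"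
    have Zb0: "cmod (Zb d') > 0" using big \<kappa>_pos by linarith
    have "\<theta> > 0" using big Zb0 by (simp add: \<theta>_def)
    then have \<epsilon>: "0 < \<epsilon>" "\<epsilon> \<le> 1 / 2" "\<epsilon> < \<theta>"
      by (auto simp: \<epsilon>_def min_def)
    have \<kappa>_lt: "\<kappa> < (1 - \<epsilon>) * cmod (Zb d')"
      using \<epsilon>(3) Zb0 by (simp add: \<theta>_def field_simps)
    have norm_h: "cmod (h t) = \<eta> t * cmod (Z t d')" for t
      using eta_pos[of t] by (simp add: h_def norm_mult)
    have norm_Z_lim: "(\<lambda>t. cmod (Z t e) / nz t) \<longlonglongrightarrow> cmod (Zb e)" for e
    proof -
      have "(\<lambda>t. cmod (Z t e / of_real (nz t))) \<longlonglongrightarrow> cmod (Zb e)"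
        by (intro tendsto_norm Z_lim)
      then show ?thesis using nz_pos by (simp add: norm_divide less_imp_le abs_of_pos)
    qed
    have slower: "\<forall>\<^sub>F t in sequentially. cmod (Z t d) \<le> (1 - \<epsilon>) * cmod (Z t d')"
    proof -
      have "(\<lambda>t. (1 - \<epsilon>) * (cmod (Z t d') / nz t) - cmod (Z t d) / nz t) \<longlonglongrightarrow> (1 - \<epsilon>) * cmod (Zb d') - cmod (Zb d)"
        by (intro tendsto_intros norm_Z_lim)
      moreover have "(1 - \<epsilon>) * cmod (Zb d') - cmod (Zb d) > 0"
        using \<kappa>_lt norm_Zb_active[OF L d] by simp
      ultimately have "\<forall>\<^sub>F t in sequentially. (1 - \<epsilon>) * (cmod (Z t d') / nz t) - cmod (Z t d) / nz t > 0"
        by (rule order_tendstoD(1))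
      then show ?thesis
      proof eventually_elim
        case (elim t)
        then have "cmod (Z t d) / nz t \<le> ((1 - \<epsilon>) * cmod (Z t d')) / nz t" by simp
        then show ?case using nz_pos[of t] by (simp add: divide_le_cancel)
      qed
    qed
    have dir: "\<forall>\<^sub>F t in sequentially. cmod (h t - of_real (cmod (h t)) * \<xi>) \<le> \<epsilon> / 2 * cmod (h t)"
    proof -
      have "(\<lambda>t. \<epsilon> / 2 * (cmod (Z t d') / nz t) - cmod (Z t d' / of_real (nz t) - of_real (cmod (Z t d') / nz t) * \<xi>))
         \<longlonglongrightarrow> \<epsilon> / 2 * cmod (Zb d') - cmod (Zb d' - of_real (cmod (Zb d')) * \<xi>)"
        by (intro tendsto_intros norm_Z_lim Z_lim)
      moreover have "Zb d' - of_real (cmod (Zb d')) * \<xi> = 0"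
        using Zb0 by (simp add: \<xi>_def sgn_eq)
      ultimately have "(\<lambda>t. \<epsilon> / 2 * (cmod (Z t d') / nz t) - cmod (Z t d' / of_real (nz t) - of_real (cmod (Z t d') / nz t) * \<xi>))
         \<longlonglongrightarrow> \<epsilon> / 2 * cmod (Zb d')" by simp
      then have "\<forall>\<^sub>F t in sequentially. \<epsilon> / 2 * (cmod (Z t d') / nz t) - cmod (Z t d' / of_real (nz t) - of_real (cmod (Z t d') / nz t) * \<xi>) > 0"
        by (rule order_tendstoD(1)) (use \<epsilon> Zb0 in simp)
      then show ?thesis
      proof eventually_elim
        case (elim t)
        define q where "q = \<eta> t * nz t"
        have q: "q > 0" using eta_pos nz_pos by (simp add: q_def)
        have "h t = of_real q * (Z t d' / of_real (nz t))" "cmod (h t) = q * (cmod (Z t d') / nz t)"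
          unfolding norm_h using nz_pos[of t] by (simp_all add: h_def q_def)
        then have "cmod (h t - of_real (cmod (h t)) * \<xi>)
           = cmod (of_real q * (Z t d' / of_real (nz t) - of_real (cmod (Z t d') / nz t) * \<xi>))"
          by (simp add: right_diff_distrib mult.assoc)
        also have "\<dots> = q * cmod (Z t d' / of_real (nz t) - of_real (cmod (Z t d') / nz t) * \<xi>)"
          using q by (simp add: norm_mult)
        also have "\<dots> \<le> q * (\<epsilon> / 2 * (cmod (Z t d') / nz t))"
          using elim q by (intro mult_left_mono) auto
        also have "\<dots> = \<epsilon> / 2 * cmod (h t)"
          using \<open>cmod (h t) = q * (cmod (Z t d') / nz t)\<close> by simp
        finally show ?case .
      qed
    qed
    have half: "\<forall>\<^sub>F t in sequentially. cmod (h t) \<le> 1 / 2"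
    proof -
      have "\<forall>\<^sub>F t in sequentially. \<eta> t * cmod (Z t d') < 1 / 2"
        using order_tendstoD(2)[OF step_vanishes[OF L d'], of "1 / 2"] by simp
      then show ?thesis by eventually_elim (simp add: norm_h)
    qed
    obtain T0 where T0: "\<And>t. t \<ge> T0 \<Longrightarrow> cmod (Z t d) \<le> (1 - \<epsilon>) * cmod (Z t d')"
      "\<And>t. t \<ge> T0 \<Longrightarrow> cmod (h t - of_real (cmod (h t)) * \<xi>) \<le> \<epsilon> / 2 * cmod (h t)"
      "\<And>t. t \<ge> T0 \<Longrightarrow> cmod (h t) \<le> 1 / 2"
      using eventually_conj[OF slower eventually_conj[OF dir half]] unfolding eventually_sequentially by auto
    \<comment> \<open>Size of the active frequency, chosen because one step multiplies it by at most
      \<open>1 + \<eta> t * cmod (Z t d)\<close>, whatever the phases.\<close>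
    define Q where "Q t = cmod (U t 1 d) + cmod (U t 2 d)" for t
    have Q0: "Q t \<ge> 0" for t by (simp add: Q_def)
    have Q_step: "Q (Suc t) \<le> (1 + (1 - \<epsilon>) * cmod (h t)) * Q t" if t: "t \<ge> T0" for t
    proof -
      have "cmod (U (Suc t) 1 d) \<le> cmod (U t 1 d) + \<eta> t * cmod (Z t d) * cmod (U t 2 d)"
        "cmod (U (Suc t) 2 d) \<le> cmod (U t 2 d) + \<eta> t * cmod (Z t d) * cmod (U t 1 d)"
        unfolding U1[OF d(1)] U2[OF d(1)] using eta_pos[of t]
        by (auto intro!: norm_triangle_le simp: norm_mult)
      then have "Q (Suc t) \<le> (1 + \<eta> t * cmod (Z t d)) * Q t" by (simp add: Q_def algebra_simps)
      also have "\<dots> \<le> (1 + (1 - \<epsilon>) * cmod (h t)) * Q t"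
        using T0(1)[OF t] eta_pos[of t] Q0
        by (intro mult_right_mono) (auto simp: norm_h mult.left_commute)
      finally show ?thesis .
    qed
    have Q_lim: "(\<lambda>t. Q t / r t) \<longlonglongrightarrow> 2 * \<rho> d"
    proof -
      have "(\<lambda>t. cmod (U t 1 d / of_real (r t)) + cmod (U t 2 d / of_real (r t))) \<longlonglongrightarrow> cmod (Ub 1 d) + cmod (Ub 2 d)"
        by (intro tendsto_intros U_lim 12)
      then show ?thesis
        using r_pos norm_Ub[OF 12(1) d(1)] norm_Ub[OF 12(2) d(1)]
        by (simp add: Q_def norm_divide abs_of_pos add_divide_distrib)
    qed
    have Q_top: "filterlim Q at_top sequentially"
    proof -
      have "filterlim (\<lambda>t. Q t / r t * r t) at_top sequentially"
        using d by (intro filterlim_tendsto_pos_mult_at_top[OF Q_lim _ r_at_top]) simp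
      moreover have "Q t / r t * r t = Q t" for t using r_pos[of t] by simp
      ultimately show ?thesis by simp
    qed
    \<comment> \<open>The active frequency diverges, yet from \<open>T0\<close> on it grows at most
      like the exponential of these sums.\<close>
    have diverge: "filterlim (\<lambda>t. \<Sum>s<t. cmod (h s)) at_top sequentially"
    proof -
      define S where "S t = (\<Sum>s<t. cmod (h s))" for t
      define A where "A = Q T0 + 1"
      have A: "A > 0" using Q0[of T0] by (simp add: A_def)
      have Q_exp: "Q t \<le> A * exp (S t - S T0)" if "t \<ge> T0" for t
        using that
      proof (induction t rule: dec_induct)
        case (step t)
        have "Q (Suc t) \<le> (1 + (1 - \<epsilon>) * cmod (h t)) * Q t" using step by (intro Q_step)
        also have "\<dots> \<le> exp (cmod (h t)) * Q t"
        proof (rule mult_right_mono[OF _ Q0])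
          have "(1 - \<epsilon>) * cmod (h t) \<le> 1 * cmod (h t)" using \<epsilon> by (intro mult_right_mono) auto
          then show "1 + (1 - \<epsilon>) * cmod (h t) \<le> exp (cmod (h t))"
            using exp_ge_add_one_self[of "cmod (h t)"] by linarith
        qed
        also have "\<dots> \<le> exp (cmod (h t)) * (A * exp (S t - S T0))"
          using step by (intro mult_left_mono) auto
        also have "\<dots> = A * exp (S (Suc t) - S T0)"
          by (simp add: S_def mult.left_commute algebra_simps flip: exp_add)
        finally show ?case .
      qed (simp add: A_def)
      have "filterlim S at_top sequentially"
        unfolding filterlim_at_top
      proof
        fix B
        have "\<forall>\<^sub>F t in sequentially. Q t > A * exp (B - S T0) \<and> t \<ge> T0"
          using Q_top unfolding filterlim_at_top_dense
          by (intro eventually_conj eventually_ge_at_top) auto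
        then show "\<forall>\<^sub>F t in sequentially. B \<le> S t"
        proof eventually_elim
          case (elim t)
          then have "A * exp (B - S T0) < A * exp (S t - S T0)" using Q_exp[of t] by linarith
          then show ?case using A by simp
        qed
      qed
      then show ?thesis unfolding S_def[abs_def] .
    qed
    have h_lt: "cmod (h t) < 1" for t
      using mode_step_less_1[OF 12(1,2) _ d', of t] unfolding 12(5) by (simp add: norm_h)
    have \<xi>1: "cmod \<xi> = 1" using Zb0 by (simp add: \<xi>_def norm_sgn)
    obtain p T where p: "T \<ge> T0" "p T > 0"
      "\<And>t. t \<ge> T \<Longrightarrow> p (Suc t) \<ge> (1 + (1 - \<epsilon>) * cmod (h t)) * p t"
      "\<And>t. p t \<le> cmod (U t 1 d') + cmod (U t 2 d')"
    proof (rule cone_growth[of "\<lambda>t. U t 1 d'" h "\<lambda>t. U t 2 d'" \<xi> \<epsilon> T0])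
      show "U (Suc t) 1 d' = U t 1 d' + h t * cnj (U t 2 d')" for t
        unfolding h_def by (rule U1[OF d'])
      show "U (Suc t) 2 d' = U t 2 d' + h t * cnj (U t 1 d')" for t
        unfolding h_def by (rule U2[OF d'])
    qed (use h_lt init \<xi>1 \<epsilon> T0 diverge in auto)
    \<comment> \<open>The same factor bounds the growth of \<open>Q\<close> from above and that of
      \<open>p\<close> from below, so \<open>Q / p\<close> cannot increase. After division by
      \<open>r t\<close> this contradicts \<open>\<rho> d > 0\<close> and
      \<open>\<rho> d' = 0\<close>.\<close>
    have compare: "Q t * p T \<le> p t * Q T" if "t \<ge> T" for t
      using that
    proof (induction t rule: dec_induct)
      case (step t)
      define k where "k = 1 + (1 - \<epsilon>) * cmod (h t)"
      have k0: "k \<ge> 0" using \<epsilon> by (simp add: k_def)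
      have "Q (Suc t) * p T \<le> (k * Q t) * p T"
        using step p(1,2) by (intro mult_right_mono) (auto simp: k_def intro!: Q_step)
      also have "\<dots> = k * (Q t * p T)" by simp
      also have "\<dots> \<le> k * (p t * Q T)" using step k0 by (intro mult_left_mono)
      also have "\<dots> = (k * p t) * Q T" by simp
      also have "\<dots> \<le> p (Suc t) * Q T"
        using p(3)[of t] step Q0 by (intro mult_right_mono) (auto simp: k_def)
      finally show ?case .
    qed (simp add: mult.commute)
    have "(\<lambda>t. Q t / r t * p T) \<longlonglongrightarrow> 2 * \<rho> d * p T"
      by (intro tendsto_intros Q_lim)
    moreover have "(\<lambda>t. (cmod (U t 1 d' / of_real (r t)) + cmod (U t 2 d' / of_real (r t))) * Q T)
       \<longlonglongrightarrow> (cmod (Ub 1 d') + cmod (Ub 2 d')) * Q T"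
      by (intro tendsto_intros U_lim 12)
    moreover have "\<forall>t\<ge>T. Q t / r t * p T \<le> (cmod (U t 1 d' / of_real (r t)) + cmod (U t 2 d' / of_real (r t))) * Q T"
    proof (intro allI impI)
      fix t assume "t \<ge> T"
      then have "Q t * p T \<le> p t * Q T" by (rule compare)
      also have "\<dots> \<le> (cmod (U t 1 d') + cmod (U t 2 d')) * Q T"
        using p(4) Q0 by (rule mult_right_mono)
      finally have "Q t * p T / r t \<le> (cmod (U t 1 d') + cmod (U t 2 d')) * Q T / r t"
        using r_pos[of t] by (intro divide_right_mono) auto
      then show "Q t / r t * p T \<le> (cmod (U t 1 d' / of_real (r t)) + cmod (U t 2 d' / of_real (r t))) * Q T"
        using r_pos[of t] by (simp add: norm_divide add_divide_distrib[symmetric])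
    qed
    ultimately have "2 * \<rho> d * p T \<le> (cmod (Ub 1 d') + cmod (Ub 2 d')) * Q T"
      by (intro LIMSEQ_le) auto
    then have "\<rho> d * p T \<le> 0"
      using norm_Ub[OF 12(1) d'] norm_Ub[OF 12(2) d'] \<rho>0 by (simp add: mult.commute)
    then show False using d p(2) by (simp add: mult_le_0_iff)
  qed
qed

end

section \<open>Stationarity of the limit\<close>

context conv_gd_limit
begin

text \<open>Multiply \<open>mode_stationary\<close> by \<open>\<Omega> d\<close>. The exponent
  arises from \<open>cmod (\<Omega> d) = \<rho> d ^ L\<close>, which makes
  \<open>(\<rho> d)\<^sup>2\<close> the power \<open>2 / L\<close> of
  \<open>cmod (\<Omega> d)\<close>.\<close>

lemma mode_optimality:
  assumes d: "d < D" and nz: "\<Omega> d \<noteq> 0"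
  shows "Zb d = of_real (\<kappa> * cmod (\<Omega> d) powr (2 / real L - 1)) * sgn (\<Omega> d)"
proof -
  have norm: "cmod (\<Omega> d) = \<rho> d ^ L" by (rule norm_\<Omega>[OF d])
  have \<rho>: "\<rho> d > 0"
  proof -
    have "\<rho> d \<noteq> 0" using nz norm L1 by (auto simp: zero_power)
    then show ?thesis by (simp add: \<rho>_def)
  qed
  have "cmod (\<Omega> d) powr (2 / real L) = (\<rho> d)\<^sup>2"
  proof -
    have "cmod (\<Omega> d) powr (2 / real L) = (\<rho> d powr real L) powr (2 / real L)"
      by (simp only: norm powr_realpow[OF \<rho>])
    also have "\<dots> = \<rho> d powr 2" using L1 by (simp add: powr_powr)
    also have "\<dots> = (\<rho> d)\<^sup>2" using \<rho> by simp
    finally show ?thesis .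
  qed
  then have pw: "cmod (\<Omega> d) powr (2 / real L - 1) = (\<rho> d)\<^sup>2 / cmod (\<Omega> d)"
    using nz by (simp add: powr_diff)
  have "Zb d * (cnj (\<Omega> d) * \<Omega> d) = of_real (\<kappa> * (\<rho> d)\<^sup>2) * \<Omega> d"
    using mode_stationary[OF d] by (simp flip: mult.assoc)
  also have "cnj (\<Omega> d) * \<Omega> d = (of_real (cmod (\<Omega> d)))\<^sup>2"
    unfolding mult.commute[of "cnj _"] of_real_power[symmetric] by (rule complex_norm_square[symmetric])
  finally have "Zb d = of_real (\<kappa> * (\<rho> d)\<^sup>2) * \<Omega> d / (of_real (cmod (\<Omega> d)))\<^sup>2"
    using nz by (simp add: eq_divide_eq)
  then show ?thesis
    unfolding pw sgn_eq by (simp add: power2_eq_square)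
qed

lemma stationary_direction:
  assumes init: "\<And>d. L = 2 \<Longrightarrow> d < D \<Longrightarrow> cmod (U 0 1 d) \<noteq> cmod (U 0 2 d)"
  shows "\<exists>\<gamma>>0. \<exists>ws. first_order_stationary D L N x y ws \<and> (\<forall>k<D. wbar k = \<gamma> * ws k)"
proof -
  \<comment> \<open>Dividing by the least limiting margin makes the constraints tight exactly at the
    points attaining it, the only ones with a nonzero multiplier.\<close>
  define ws where "ws = (\<lambda>k. (1 / \<mu>0) * wbar k)"
  define p where "p = 2 / real L"
  define c0 where "c0 = K * \<mu>0"
  \<comment> \<open>Rescales the multipliers: since \<open>dft D ws d = \<Omega> d / c0\<close>, it
    turns \<open>\<kappa> * cmod (\<Omega> d) powr (p - 1)\<close> into
    \<open>p * cmod (dft D ws d) powr (p - 1)\<close>. For \<open>p = 1\<close> it is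
    \<open>1 / \<kappa>\<close>, so \<open>cmod (Zb d) \<le> \<kappa>\<close> becomes the unit
    bound.\<close>
  define s where "s = p * c0 powr (1 - p) / \<kappa>"
  have c0: "c0 > 0" using K_pos \<mu>0_pos by (simp add: c0_def)
  have p: "p > 0" using L1 by (simp add: p_def)
  have s: "s > 0" using p c0 \<kappa>_pos by (simp add: s_def)
  obtain \<alpha> where \<alpha>: "\<And>n. n < N \<Longrightarrow> \<alpha> n \<ge> 0" "\<And>n. n < N \<Longrightarrow> \<mu> n > \<mu>0 \<Longrightarrow> \<alpha> n = 0"
    "\<And>d. Zb d = (\<Sum>n<N. of_real (\<alpha> n * y n) * dft D (x n) d)"
    by (rule dual_variables) blast
  have margin: "y n * inner_D D (x n) ws = \<mu> n / \<mu>0" "y n * inner_D D ws (x n) = \<mu> n / \<mu>0" for n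
    by (simp_all add: ws_def \<mu>_def inner_D_def sum_distrib_left sum_divide_distrib mult_ac)
  have dft_ws: "dft D ws d = \<Omega> d / of_real c0" if "d < D" for d
    unfolding ws_def dft_scale dft_wbar[OF that] by (simp add: c0_def)
  have dual: "(\<Sum>n<N. of_real (s * \<alpha> n * y n) * dft D (x n) d) = of_real s * Zb d" for d
    by (simp add: \<alpha>(3) sum_distrib_left mult.assoc)
  have active: "of_real s * Zb d = of_real (p * cmod (dft D ws d) powr (p - 1)) * phase (dft D ws d)"
    if d: "d < D" and nz: "dft D ws d \<noteq> 0" for d
  proof -
    have \<Omega>: "\<Omega> d \<noteq> 0" using nz dft_ws[OF d] by auto
    have "phase (dft D ws d) = sgn (\<Omega> d)"
    proof -
      have "phase (dft D ws d) = sgn (dft D ws d)"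
        unfolding phase_def by (rule cis_Arg[OF nz])
      then show ?thesis using c0 by (simp add: dft_ws[OF d] sgn_eq norm_divide)
    qed
    moreover have "cmod (dft D ws d) powr (p - 1) = cmod (\<Omega> d) powr (p - 1) * c0 powr (1 - p)"
    proof -
      have "c0 powr (1 - p) = 1 / c0 powr (p - 1)"
        using powr_minus_divide[of c0 "p - 1"] by simp
      then show ?thesis using c0 by (simp add: dft_ws[OF d] norm_divide powr_divide)
    qed
    moreover have "of_real s * Zb d = of_real (p * (q * c0 powr (1 - p))) * sgn (\<Omega> d)"
      if "q = cmod (\<Omega> d) powr (p - 1)" for q
    proof -
      have "Zb d = of_real (\<kappa> * q) * sgn (\<Omega> d)"
        unfolding p_def that by (rule mode_optimality[OF d \<Omega>])
      then show ?thesis using \<kappa>_pos by (simp add: s_def)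
    qed
    ultimately show ?thesis by (simp only:)
  qed
  have inactive: "cmod (of_real s * Zb d) \<le> 1" if "p = 1" "d < D" for d
  proof -
    have "L = 2" using that(1) L1 by (simp add: p_def divide_eq_eq)
    then have "cmod (Zb d) \<le> \<kappa>" using norm_Zb_le init that by blast
    then show ?thesis
      using that(1) c0 \<kappa>_pos by (simp add: s_def norm_mult norm_divide)
  qed
  have "clarke_subdiff_pnorm D p (dft D ws) (\<lambda>d. \<Sum>n<N. of_real (s * \<alpha> n * y n) * dft D (x n) d)"
  proof (cases "p = 1")
    case True
    have "of_real s * Zb d = phase (dft D ws d)" if "d < D" "dft D ws d \<noteq> 0" for d
      using active[OF that] that True by simp
    then show ?thesis
      unfolding clarke_subdiff_pnorm_def dual using True inactive by simp
  next
    case False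
    then show ?thesis
      unfolding clarke_subdiff_pnorm_def dual using active by simp
  qed
  moreover have "s * \<alpha> n \<ge> 0 \<and> (y n * inner_D D (x n) ws > 1 \<longrightarrow> s * \<alpha> n = 0)" if "n < N" for n
    using \<alpha>(1,2)[OF that] s \<mu>0_pos by (simp add: margin)
  moreover have "y n * inner_D D ws (x n) \<ge> 1" if "n < N" for n
    using \<mu>0_le[OF that] \<mu>0_pos by (simp add: margin)
  ultimately have "first_order_stationary D L N x y ws"
    unfolding first_order_stationary_def p_def[symmetric]
    by (intro conjI allI impI exI[of _ "\<lambda>n. s * \<alpha> n"]) auto
  moreover have "\<forall>k<D. wbar k = \<mu>0 * ws k" using \<mu>0_pos by (simp add: ws_def)
  ultimately show ?thesis using \<mu>0_pos by blast
qed

end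

section \<open>Exceptional initializations form a null set\<close>

lemma (in product_sigma_finite) AE_PiM_insert:
  assumes I: "finite I" "i \<notin> I"
    and meas: "Measurable.pred (Pi\<^sub>M (insert i I) M) P"
    and slices: "\<And>x. x \<in> space (Pi\<^sub>M I M) \<Longrightarrow> AE v in M i. P (x(i := v))"
  shows "AE x in Pi\<^sub>M (insert i I) M. P x"
proof -
  let ?B = "{x \<in> space (Pi\<^sub>M (insert i I) M). \<not> P x}"
  have B: "?B \<in> sets (Pi\<^sub>M (insert i I) M)" using meas by measurable
  have "emeasure (Pi\<^sub>M (insert i I) M) ?B = (\<integral>\<^sup>+ x. indicator ?B x \<partial>Pi\<^sub>M (insert i I) M)"
    using B by simp
  \<comment> \<open>Fubini over the inserted coordinate; by hypothesis every slice of the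
    exceptional set is null.\<close>
  also have "\<dots> = (\<integral>\<^sup>+ x. (\<integral>\<^sup>+ v. indicator ?B (x(i := v)) \<partial>M i) \<partial>Pi\<^sub>M I M)"
    using B by (intro product_nn_integral_insert I) simp
  also have "\<dots> = (\<integral>\<^sup>+ x. 0 \<partial>Pi\<^sub>M I M)"
  proof (rule nn_integral_cong)
    fix x assume "x \<in> space (Pi\<^sub>M I M)"
    from slices[OF this] have "AE v in M i. indicator ?B (x(i := v)) = (0::ennreal)"
      by eventually_elim (simp add: indicator_def)
    then show "(\<integral>\<^sup>+ v. indicator ?B (x(i := v)) \<partial>M i) = 0"
      by (subst nn_integral_cong_AE[of _ "\<lambda>_. 0"]) auto
  qed
  finally have "emeasure (Pi\<^sub>M (insert i I) M) ?B = 0" by simp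
  then show ?thesis using B by (intro AE_I[of _ _ ?B]) auto
qed

lemma measurable_dft:
  "(\<lambda>v. dft D v d) \<in> borel_measurable (\<Pi>\<^sub>M k\<in>{..<D}. lborel)"
  unfolding dft_def by measurable

lemma dft_upd_0:
  assumes "D \<ge> 1"
  shows "dft D (v(0 := s)) d = (of_real s + (\<Sum>p\<in>{1..<D}. of_real (v p) * cnj (wave D p d))) / of_real (sqrt (real D))"
proof -
  have "{..<D} = insert 0 {1..<D}" using assms by auto
  then show ?thesis by (simp add: dft_wave wave_def)
qed

text \<open>Varying entry 0 translates the transform parallel to the real axis, and a horizontal
  line meets a circle in at most two points.\<close>

lemma AE_cmod_dft_neq:
  assumes D: "D \<ge> 1"
  shows "AE v in (\<Pi>\<^sub>M k\<in>{..<D}. lborel). cmod (dft D v d) \<noteq> c"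
proof -
  interpret product_sigma_finite "\<lambda>k::nat. lborel :: real measure"
    by (simp add: product_sigma_finite_def sigma_finite_lborel)
  have ins: "{..<D} = insert 0 {1..<D}" using D by auto
  have "AE v in (\<Pi>\<^sub>M k\<in>insert 0 {1..<D}. lborel). cmod (dft D v d) \<noteq> c"
  proof (rule AE_PiM_insert)
    show "Measurable.pred (\<Pi>\<^sub>M k\<in>insert 0 {1..<D}. lborel) (\<lambda>v. cmod (dft D v d) \<noteq> c)"
      using measurable_dft[of D d] unfolding ins by measurable
    fix v :: "nat \<Rightarrow> real"
    define B where "B = (\<Sum>p\<in>{1..<D}. of_real (v p) * cnj (wave D p d))"
    define R where "R = sqrt (c\<^sup>2 * D - (Im B)\<^sup>2)"
    have root: "s \<in> {- Re B + R, - Re B - R}" if "cmod (dft D (v(0 := s)) d) = c" for s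
    proof -
      have "cmod (of_real s + B) = c * sqrt D"
        using that D unfolding dft_upd_0[OF D] B_def[symmetric] by (simp add: norm_divide divide_eq_eq)
      then have "(cmod (of_real s + B))\<^sup>2 = c\<^sup>2 * D" by (simp add: power_mult_distrib)
      then have "(s + Re B)\<^sup>2 = c\<^sup>2 * D - (Im B)\<^sup>2" by (simp add: cmod_power2)
      then have "\<bar>s + Re B\<bar> = R" unfolding R_def by (metis real_sqrt_abs)
      then show ?thesis by auto
    qed
    have "AE s in lborel. s \<notin> {- Re B + R, - Re B - R}"
      by (intro AE_not_in countable_imp_null_set_lborel) simp
    then show "AE s in lborel. cmod (dft D (v(0 := s)) d) \<noteq> c"
      by (rule eventually_mono) (use root in blast)
  qed auto
  then show ?thesis by (simp only: ins)
qed

text \<open>With layer 2 fixed, layer 1 has to avoid one modulus at each frequency; there are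
  finitely many frequencies.\<close>

lemma AE_generic_initialization:
  assumes D: "D \<ge> 1"
  shows "AE u0 in (\<Pi>\<^sub>M l\<in>{1..2::nat}. \<Pi>\<^sub>M k\<in>{..<D}. lborel).
    \<forall>d<D. cmod (dft D (u0 1) d) \<noteq> cmod (dft D (u0 2) d)"
proof -
  let ?M = "\<lambda>l::nat. \<Pi>\<^sub>M k\<in>{..<D}. (lborel :: real measure)"
  interpret L: product_sigma_finite "\<lambda>k::nat. lborel :: real measure"
    by (simp add: product_sigma_finite_def sigma_finite_lborel)
  interpret product_sigma_finite ?M
    by (simp add: product_sigma_finite_def L.sigma_finite)
  have ins: "{1..2::nat} = insert (1::nat) {2}" by auto
  have "AE u0 in (\<Pi>\<^sub>M l\<in>insert (1::nat) {2}. ?M l). cmod (dft D (u0 1) d) \<noteq> cmod (dft D (u0 2) d)" for d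
  proof (rule AE_PiM_insert)
    have meas: "(\<lambda>u0. cmod (dft D (u0 l) d)) \<in> borel_measurable (\<Pi>\<^sub>M l\<in>insert (1::nat) {2}. ?M l)"
      if "l \<in> insert (1::nat) {2}" for l
    proof -
      have "(\<lambda>u0. u0 l) \<in> measurable (\<Pi>\<^sub>M l\<in>insert (1::nat) {2}. ?M l) (?M l)"
        using that by (rule measurable_component_singleton)
      from measurable_compose[OF this measurable_dft] show ?thesis
        by (rule measurable_compose[OF _ borel_measurable_norm])
    qed
    show "Measurable.pred (\<Pi>\<^sub>M l\<in>insert (1::nat) {2}. ?M l) (\<lambda>u0. cmod (dft D (u0 1) d) \<noteq> cmod (dft D (u0 2) d))"
      unfolding pred_def by (intro borel_measurable_neq meas) auto
    show "AE v in ?M 1. cmod (dft D ((v2(1 := v)) 1) d) \<noteq> cmod (dft D ((v2(1 := v)) 2) d)" for v2 :: "nat \<Rightarrow> nat \<Rightarrow> real"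
      using AE_cmod_dft_neq[OF D, of d "cmod (dft D (v2 2) d)"] by simp
  qed auto
  then have "AE u0 in (\<Pi>\<^sub>M l\<in>{1..2::nat}. ?M l). \<forall>d\<in>{..<D}. cmod (dft D (u0 1) d) \<noteq> cmod (dft D (u0 2) d)"
    unfolding ins by (subst AE_ball_countable) auto
  then show ?thesis by (simp add: Ball_def)
qed

theorem mainTheorem3:
  fixes D L N :: nat
  assumes "L \<ge> 2" and "D \<ge> 1" and "N \<ge> 1"
  shows "\<forall>y :: nat \<Rightarrow> real. (\<forall>n<N. y n \<in> {-1, 1}) \<longrightarrow>
    (AE x in (\<Pi>\<^sub>M n\<in>{..<N}. \<Pi>\<^sub>M k\<in>{..<D}. lborel).
       linearly_separable D N x y \<longrightarrow>
       (AE u0 in (\<Pi>\<^sub>M l\<in>{1..L}. \<Pi>\<^sub>M k\<in>{..<D}. lborel).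
          \<forall>(u :: nat \<Rightarrow> nat \<Rightarrow> nat \<Rightarrow> real) (\<eta> :: nat \<Rightarrow> real) (wbar :: nat \<Rightarrow> real).
            (\<forall>l\<in>{1..L}. \<forall>k<D. u 0 l k = u0 l k) \<and>
            (\<forall>t. step_size_ok D L N x y (u t) (\<eta> t)) \<and>
            (\<forall>t. \<forall>l\<in>{1..L}. \<forall>k<D.
                u (Suc t) l k = u t l k - \<eta> t * grad_params D L N x y (u t) l k) \<and>
            ((\<lambda>t. conv_loss D L N x y (u t)) \<longlonglongrightarrow> 0) \<and>
            (\<exists>ubar. \<forall>l\<in>{1..L}. \<forall>k<D.
                ((\<lambda>t. u t l k / pnorm D L (u t)) \<longlonglongrightarrow> ubar l k)) \<and>
            (\<forall>k<D. ((\<lambda>t. P_conv D L (u t) k / vnorm D (P_conv D L (u t))) \<longlonglongrightarrow> wbar k)) \<and>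
            Min ((\<lambda>n. y n * inner_D D (x n) wbar) ` {..<N}) > 0 \<and>
            (\<forall>d<D. \<exists>c. ((\<lambda>t. phase (dft D (P_conv D L (u t)) d)) \<longlonglongrightarrow> c)) \<and>
            (\<exists>g. \<forall>k<D. ((\<lambda>t. grad_w D N x y (P_conv D L (u t)) k
                              / vnorm D (grad_w D N x y (P_conv D L (u t)))) \<longlonglongrightarrow> g k))
            \<longrightarrow> (\<exists>\<gamma>>0. \<exists>ws. first_order_stationary D L N x y ws \<and>
                                (\<forall>k<D. wbar k = \<gamma> * ws k))))"
proof (rule allI, rule impI, rule AE_I2, rule impI)
  fix y :: "nat \<Rightarrow> real" and x :: "nat \<Rightarrow> nat \<Rightarrow> real"
  assume y: "\<forall>n<N. y n \<in> {-1, 1}"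
  \<comment> \<open>Initializations are excluded only for \<open>L = 2\<close>, the case in which
    the subdifferential bounds the frequencies where the limit vanishes.\<close>
  have "AE u0 in (\<Pi>\<^sub>M l\<in>{1..L}. \<Pi>\<^sub>M k\<in>{..<D}. lborel).
      L = 2 \<longrightarrow> (\<forall>d<D. cmod (dft D (u0 1) d) \<noteq> cmod (dft D (u0 2) d))"
  proof (cases "L = 2")
    case True
    show ?thesis
      unfolding True by (rule eventually_mono[OF AE_generic_initialization[OF assms(2)]]) blast
  qed simp
  then show "AE u0 in (\<Pi>\<^sub>M l\<in>{1..L}. \<Pi>\<^sub>M k\<in>{..<D}. lborel).
          \<forall>(u :: nat \<Rightarrow> nat \<Rightarrow> nat \<Rightarrow> real) (\<eta> :: nat \<Rightarrow> real) (wbar :: nat \<Rightarrow> real).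
            (\<forall>l\<in>{1..L}. \<forall>k<D. u 0 l k = u0 l k) \<and>
            (\<forall>t. step_size_ok D L N x y (u t) (\<eta> t)) \<and>
            (\<forall>t. \<forall>l\<in>{1..L}. \<forall>k<D.
                u (Suc t) l k = u t l k - \<eta> t * grad_params D L N x y (u t) l k) \<and>
            ((\<lambda>t. conv_loss D L N x y (u t)) \<longlonglongrightarrow> 0) \<and>
            (\<exists>ubar. \<forall>l\<in>{1..L}. \<forall>k<D.
                ((\<lambda>t. u t l k / pnorm D L (u t)) \<longlonglongrightarrow> ubar l k)) \<and>
            (\<forall>k<D. ((\<lambda>t. P_conv D L (u t) k / vnorm D (P_conv D L (u t))) \<longlonglongrightarrow> wbar k)) \<and>
            Min ((\<lambda>n. y n * inner_D D (x n) wbar) ` {..<N}) > 0 \<and>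
            (\<forall>d<D. \<exists>c. ((\<lambda>t. phase (dft D (P_conv D L (u t)) d)) \<longlonglongrightarrow> c)) \<and>
            (\<exists>g. \<forall>k<D. ((\<lambda>t. grad_w D N x y (P_conv D L (u t)) k
                              / vnorm D (grad_w D N x y (P_conv D L (u t)))) \<longlonglongrightarrow> g k))
            \<longrightarrow> (\<exists>\<gamma>>0. \<exists>ws. first_order_stationary D L N x y ws \<and>
                                (\<forall>k<D. wbar k = \<gamma> * ws k))"
  proof (rule eventually_mono, intro allI impI, elim conjE exE)
    fix u0 u \<eta> wbar ubar g
    assume gen: "L = 2 \<longrightarrow> (\<forall>d<D. cmod (dft D (u0 1) d) \<noteq> cmod (dft D (u0 2) d))"
      and u0: "\<forall>l\<in>{1..L}. \<forall>k<D. u 0 l k = u0 l k"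
      and step: "\<forall>t. step_size_ok D L N x y (u t) (\<eta> t)"
      and upd: "\<forall>t. \<forall>l\<in>{1..L}. \<forall>k<D. u (Suc t) l k = u t l k - \<eta> t * grad_params D L N x y (u t) l k"
      and loss: "(\<lambda>t. conv_loss D L N x y (u t)) \<longlonglongrightarrow> 0"
      and ubar: "\<forall>l\<in>{1..L}. \<forall>k<D. (\<lambda>t. u t l k / pnorm D L (u t)) \<longlonglongrightarrow> ubar l k"
      and wbar: "\<forall>k<D. (\<lambda>t. P_conv D L (u t) k / vnorm D (P_conv D L (u t))) \<longlonglongrightarrow> wbar k"
      and margin: "0 < Min ((\<lambda>n. y n * inner_D D (x n) wbar) ` {..<N})"
      and g: "\<forall>k<D. (\<lambda>t. grad_w D N x y (P_conv D L (u t)) k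
                / vnorm D (grad_w D N x y (P_conv D L (u t)))) \<longlonglongrightarrow> g k"
    have "(y n)\<^sup>2 = 1" if "n < N" for n
      using y that by force
    moreover have "y n * inner_D D (x n) wbar > 0" if "n < N" for n
    proof -
      have "Min ((\<lambda>n. y n * inner_D D (x n) wbar) ` {..<N}) \<le> y n * inner_D D (x n) wbar"
        using that by (intro Min_le) auto
      then show ?thesis using margin by linarith
    qed
    ultimately interpret conv_gd_limit D L N x y u \<eta> ubar wbar g
      using assms step upd loss ubar wbar g by unfold_locales auto
    have "U 0 l d = dft D (u0 l) d" if "l \<in> {1..L}" for l d
      unfolding U_def using u0 that by (intro dft_cong) auto
    then show "\<exists>\<gamma>>0. \<exists>ws. first_order_stationary D L N x y ws \<and> (\<forall>k<D. wbar k = \<gamma> * ws k)"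
      using gen assms by (intro stationary_direction) auto
  qed
qed

end
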